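(* Let $G$ be a finitely generated group that is densely related. Then no asymptotic cone of $G$ is simply connected.
   Context: For a group $G$ with a generating subset $S$, let $F_S$ be the free group on $S$ with its word length, let $N$ be the kernel of the natural map $F_S\to G$, and for $n\ge 0$ let $N_n$ be the normal subgroup of $F_S$ generated (as a normal subgroup) by the elements of $N$ of length at most $n$ ($N_{-1}$ is trivial). The relation range $\mathcal{R}_S(G)$ is the set of integers $n\ge 0$ such that $N_n$ properly contains $N_{n-1}$. A finitely generated group $G$ is densely related if, for a finite generating subset $S$, there exists $c>0$ such that for all integers $n\ge 1$ we have $\mathcal{R}_S(G)\cap[n,cn]\neq\emptyset$ (this does not depend on the choice of finite generating subset $S$). Asymptotic cones: for a non-principal ultrafilter $\omega$ on $\mathbf{N}$, a sequence $(x_n)$ of points of $G$ and a sequence of positive numbers $(s_n)$ with $\lim_\omega s_n=+\infty$, the asymptotic cone $\mathrm{Cone}^\omega(G,(x_n),(s_n))$ is the $\omega$-ultralimit of the pointed metric spaces $(G,\tfrac{1}{s_n}d_S,x_n)$, where $d_S$ is the word metric for a finite generating subset $S$. *)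

theory Defs
  imports "HOL-Analysis.Analysis" "HOL-Algebra.Generated_Groups"
begin

section \<open>Free groups\<close>

text \<open>A letter \<open>(s, True)\<close> stands for the generator \<open>s\<close>, and \<open>(s, False)\<close> for its formal inverse.
  The free group on \<open>S\<close> consists of the reduced words over \<open>S\<close>, so that the word length of an
  element is the length of the list representing it. Distinct elements of \<open>S\<close> are always distinct
  free generators, even if \<open>S\<close> is a subset of a group that contains an element and its inverse.\<close>

type_synonym 'a word = "('a \<times> bool) list"

definition inv_letter :: "'a \<times> bool \<Rightarrow> 'a \<times> bool" where
  "inv_letter a = (fst a, \<not> snd a)"

fun reduced_word :: "'a word \<Rightarrow> bool" where
  "reduced_word (a # b # w) \<longleftrightarrow> b \<noteq> inv_letter a \<and> reduced_word (b # w)"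
| "reduced_word _ \<longleftrightarrow> True"

fun cons_reduced :: "'a \<times> bool \<Rightarrow> 'a word \<Rightarrow> 'a word" where
  "cons_reduced a [] = [a]"
| "cons_reduced a (b # w) = (if b = inv_letter a then w else a # b # w)"

definition free_group :: "'a set \<Rightarrow> 'a word monoid" where
  "free_group S =
     \<lparr>carrier = {w \<in> lists (S \<times> UNIV). reduced_word w},
      mult = foldr cons_reduced,
      one = []\<rparr>"

definition eval_letter :: "('a, 'b) monoid_scheme \<Rightarrow> 'a \<times> bool \<Rightarrow> 'a" where
  "eval_letter G a = (if snd a then fst a else inv\<^bsub>G\<^esub> (fst a))"

definition eval_word :: "('a, 'b) monoid_scheme \<Rightarrow> 'a word \<Rightarrow> 'a" where
  "eval_word G w = foldr (\<lambda>a g. eval_letter G a \<otimes>\<^bsub>G\<^esub> g) w \<one>\<^bsub>G\<^esub>"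


section \<open>Densely related groups\<close>

definition finite_generating_set :: "('a, 'b) monoid_scheme \<Rightarrow> 'a set \<Rightarrow> bool" where
  "finite_generating_set G S \<longleftrightarrow> finite S \<and> S \<subseteq> carrier G \<and> generate G S = carrier G"

definition finitely_generated_group :: "('a, 'b) monoid_scheme \<Rightarrow> bool" where
  "finitely_generated_group G \<longleftrightarrow> group G \<and> (\<exists>S. finite_generating_set G S)"

definition relators :: "('a, 'b) monoid_scheme \<Rightarrow> 'a set \<Rightarrow> 'a word set" where
  "relators G S = kernel (free_group S) G (eval_word G)"

text \<open>The length bound is an integer so that \<open>-1\<close> is allowed; it gives the trivial subgroup,
  see \<open>short_relators_closure_trivial\<close> below.\<close>

definition short_relators_closure :: "('a, 'b) monoid_scheme \<Rightarrow> 'a set \<Rightarrow> int \<Rightarrow> 'a word set" where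
  "short_relators_closure G S n =
     (\<lambda>H. H \<lhd> free_group S) hull {w \<in> relators G S. int (length w) \<le> n}"

definition relation_range :: "('a, 'b) monoid_scheme \<Rightarrow> 'a set \<Rightarrow> nat set" where
  "relation_range G S =
     {n. short_relators_closure G S (int n - 1) \<subset> short_relators_closure G S (int n)}"

definition densely_related :: "('a, 'b) monoid_scheme \<Rightarrow> bool" where
  "densely_related G \<longleftrightarrow>
     (\<exists>S. finite_generating_set G S \<and>
       (\<exists>c::real. c > 0 \<and>
         (\<forall>n\<ge>1. \<exists>m\<in>relation_range G S. n \<le> m \<and> real m \<le> c * real n)))"


section \<open>Ultralimits and asymptotic cones\<close>

definition word_norm :: "('a, 'b) monoid_scheme \<Rightarrow> 'a set \<Rightarrow> 'a \<Rightarrow> nat" where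
  "word_norm G S g = (LEAST k. \<exists>w \<in> lists (S \<times> UNIV). length w = k \<and> eval_word G w = g)"

text \<open>The library's \<open>Metric_space\<close> asks for symmetry and nonnegativity on the whole type; therefore
  distances are set to \<open>0\<close> outside the underlying set, here and in \<open>ultralimit_dist\<close>.\<close>

definition word_dist :: "('a, 'b) monoid_scheme \<Rightarrow> 'a set \<Rightarrow> 'a \<Rightarrow> 'a \<Rightarrow> real" where
  "word_dist G S g h =
     (if g \<in> carrier G \<and> h \<in> carrier G then real (word_norm G S (inv\<^bsub>G\<^esub> g \<otimes>\<^bsub>G\<^esub> h)) else 0)"

text \<open>Filters here may be improper, hence the condition \<open>F \<noteq> bot\<close>.\<close>

definition ultrafilter :: "'a filter \<Rightarrow> bool" where
  "ultrafilter F \<longleftrightarrow> F \<noteq> bot \<and> (\<forall>P. eventually P F \<or> eventually (\<lambda>x. \<not> P x) F)"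

definition nonprincipal_ultrafilter :: "'a filter \<Rightarrow> bool" where
  "nonprincipal_ultrafilter F \<longleftrightarrow> ultrafilter F \<and> (\<forall>a. F \<noteq> principal {a})"

text \<open>The ultralimit of the pointed metric spaces \<open>(M n, d n, x n)\<close>: sequences at
  \<open>\<omega>\<close>-bounded distance from the base points, modulo \<open>\<omega>\<close>-vanishing distance.\<close>

definition bounded_seqs ::
  "nat filter \<Rightarrow> (nat \<Rightarrow> 'a set) \<Rightarrow> (nat \<Rightarrow> 'a \<Rightarrow> 'a \<Rightarrow> real) \<Rightarrow> (nat \<Rightarrow> 'a) \<Rightarrow> (nat \<Rightarrow> 'a) set" where
  "bounded_seqs \<omega> M d x =
     {y. (\<forall>n. y n \<in> M n) \<and> (\<exists>C. eventually (\<lambda>n. d n (x n) (y n) \<le> C) \<omega>)}"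

definition asymp_seqs ::
  "nat filter \<Rightarrow> (nat \<Rightarrow> 'a set) \<Rightarrow> (nat \<Rightarrow> 'a \<Rightarrow> 'a \<Rightarrow> real) \<Rightarrow> (nat \<Rightarrow> 'a)
     \<Rightarrow> ((nat \<Rightarrow> 'a) \<times> (nat \<Rightarrow> 'a)) set" where
  "asymp_seqs \<omega> M d x =
     {(y, z). y \<in> bounded_seqs \<omega> M d x \<and> z \<in> bounded_seqs \<omega> M d x \<and>
              ((\<lambda>n. d n (y n) (z n)) \<longlongrightarrow> 0) \<omega>}"

definition ultralimit_points ::
  "nat filter \<Rightarrow> (nat \<Rightarrow> 'a set) \<Rightarrow> (nat \<Rightarrow> 'a \<Rightarrow> 'a \<Rightarrow> real) \<Rightarrow> (nat \<Rightarrow> 'a) \<Rightarrow> (nat \<Rightarrow> 'a) set set" where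
  "ultralimit_points \<omega> M d x = bounded_seqs \<omega> M d x // asymp_seqs \<omega> M d x"

definition ultralimit_dist ::
  "nat filter \<Rightarrow> (nat \<Rightarrow> 'a set) \<Rightarrow> (nat \<Rightarrow> 'a \<Rightarrow> 'a \<Rightarrow> real) \<Rightarrow> (nat \<Rightarrow> 'a)
     \<Rightarrow> (nat \<Rightarrow> 'a) set \<Rightarrow> (nat \<Rightarrow> 'a) set \<Rightarrow> real" where
  "ultralimit_dist \<omega> M d x A B =
     (if A \<in> ultralimit_points \<omega> M d x \<and> B \<in> ultralimit_points \<omega> M d x
      then THE r. \<exists>y\<in>A. \<exists>z\<in>B. ((\<lambda>n. d n (y n) (z n)) \<longlongrightarrow> r) \<omega>
      else 0)"

definition cone_points ::
  "('a, 'b) monoid_scheme \<Rightarrow> 'a set \<Rightarrow> nat filter \<Rightarrow> (nat \<Rightarrow> 'a) \<Rightarrow> (nat \<Rightarrow> real)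
     \<Rightarrow> (nat \<Rightarrow> 'a) set set" where
  "cone_points G S \<omega> x s =
     ultralimit_points \<omega> (\<lambda>n. carrier G) (\<lambda>n g h. word_dist G S g h / s n) x"

definition cone_dist ::
  "('a, 'b) monoid_scheme \<Rightarrow> 'a set \<Rightarrow> nat filter \<Rightarrow> (nat \<Rightarrow> 'a) \<Rightarrow> (nat \<Rightarrow> real)
     \<Rightarrow> (nat \<Rightarrow> 'a) set \<Rightarrow> (nat \<Rightarrow> 'a) set \<Rightarrow> real" where
  "cone_dist G S \<omega> x s =
     ultralimit_dist \<omega> (\<lambda>n. carrier G) (\<lambda>n g h. word_dist G S g h / s n) x"

definition cone_topology ::
  "('a, 'b) monoid_scheme \<Rightarrow> 'a set \<Rightarrow> nat filter \<Rightarrow> (nat \<Rightarrow> 'a) \<Rightarrow> (nat \<Rightarrow> real)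
     \<Rightarrow> (nat \<Rightarrow> 'a) set topology" where
  "cone_topology G S \<omega> x s =
     Metric_space.mtopology (cone_points G S \<omega> x s) (cone_dist G S \<omega> x s)"


section \<open>Simple connectedness\<close>

text \<open>The library's \<open>simply_connected\<close> is only about subsets of a type-class topological space.\<close>

definition simply_connected_space :: "'a topology \<Rightarrow> bool" where
  "simply_connected_space X \<longleftrightarrow>
     path_connected_space X \<and>
     (\<forall>p. pathin X p \<and> p 0 = p 1 \<longrightarrow>
        homotopic_with (\<lambda>r. r 0 = p 0 \<and> r 1 = p 0) (top_of_set {0..1::real}) X p (\<lambda>t. p 0))"


section \<open>The objects above are well defined\<close>

subsection \<open>The free group and its evaluation map\<close>

lemma inv_letter_inv [simp]: "inv_letter (inv_letter a) = a"
  by (simp add: inv_letter_def)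

lemma reduced_Cons: "reduced_word (a # w) \<Longrightarrow> reduced_word w"
  by (cases w) auto

lemma reduced_cons_reduced: "reduced_word w \<Longrightarrow> reduced_word (cons_reduced a w)"
  by (cases w) (auto dest: reduced_Cons)

lemma cons_reduced_inv: "reduced_word w \<Longrightarrow> cons_reduced a (cons_reduced (inv_letter a) w) = w"
proof (cases w)
  case (Cons b v)
  then show "reduced_word w \<Longrightarrow> ?thesis" by (cases v) auto
qed auto

lemma reduced_foldr: "reduced_word v \<Longrightarrow> reduced_word (foldr cons_reduced u v)"
  by (induction u) (auto intro: reduced_cons_reduced)

lemma foldr_cons_reduced:
  "reduced_word w \<Longrightarrow> foldr cons_reduced (cons_reduced a u) w = cons_reduced a (foldr cons_reduced u w)"
proof (cases u)
  case (Cons b v)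
  assume "reduced_word w"
  then show ?thesis using Cons cons_reduced_inv[OF reduced_foldr, of w a v] by auto
qed auto

lemma foldr_cons_reduced_assoc:
  "reduced_word w \<Longrightarrow>
    foldr cons_reduced (foldr cons_reduced u v) w = foldr cons_reduced u (foldr cons_reduced v w)"
  by (induction u) (auto simp: foldr_cons_reduced)

lemma foldr_cons_reduced_Nil: "reduced_word w \<Longrightarrow> foldr cons_reduced w [] = w"
proof (induction w)
  case (Cons a w)
  then show ?case by (cases w) auto
qed auto

lemma cons_reduced_in_lists:
  "a \<in> S \<times> UNIV \<Longrightarrow> w \<in> lists (S \<times> UNIV) \<Longrightarrow> cons_reduced a w \<in> lists (S \<times> UNIV)"
  by (cases w) auto

lemma foldr_in_lists:
  "u \<in> lists (S \<times> UNIV) \<Longrightarrow> v \<in> lists (S \<times> UNIV) \<Longrightarrow> foldr cons_reduced u v \<in> lists (S \<times> UNIV)"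
proof (induction u)
  case (Cons a u)
  then have "foldr cons_reduced u v \<in> lists (S \<times> UNIV)" "a \<in> S \<times> UNIV" by auto
  then show ?case by (simp add: cons_reduced_in_lists del: in_lists_conv_set)
qed auto

lemma foldr_cons_reduced_left_inv:
  assumes "reduced_word w" "w \<in> lists (S \<times> UNIV)"
  shows "\<exists>v \<in> lists (S \<times> UNIV). reduced_word v \<and> foldr cons_reduced v w = []"
  using assms
proof (induction w)
  case Nil
  then show ?case by (intro bexI[of _ "[]"]) auto
next
  case (Cons a w)
  then obtain v where v: "v \<in> lists (S \<times> UNIV)" "reduced_word v" "foldr cons_reduced v w = []"
    using reduced_Cons by (metis Cons_in_lists_iff)
  let ?a = "inv_letter a"
  let ?v = "foldr cons_reduced v [?a]"
  have a: "?a \<in> S \<times> UNIV" using Cons.prems(2) by (auto simp: inv_letter_def)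
  have "foldr cons_reduced ?v (a # w) = foldr cons_reduced v (foldr cons_reduced [?a] (a # w))"
    using Cons.prems by (intro foldr_cons_reduced_assoc) auto
  also have "\<dots> = []" using v by simp
  finally show ?case
    using foldr_in_lists[OF v(1), of "[?a]"] reduced_foldr[of "[?a]" v] a
    by (intro bexI[of _ ?v]) (simp_all del: in_lists_conv_set)
qed

lemma group_free_group: "group (free_group S)"
proof (rule groupI)
  fix x assume "x \<in> carrier (free_group S)"
  then show "\<exists>y\<in>carrier (free_group S). y \<otimes>\<^bsub>free_group S\<^esub> x = \<one>\<^bsub>free_group S\<^esub>"
    using foldr_cons_reduced_left_inv[of x S] by (fastforce simp: free_group_def)
qed (simp_all add: free_group_def reduced_foldr foldr_cons_reduced_assoc foldr_in_lists
       del: in_lists_conv_set)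

lemma (in group) eval_letter_closed:
  "S \<subseteq> carrier G \<Longrightarrow> a \<in> S \<times> UNIV \<Longrightarrow> eval_letter G a \<in> carrier G"
  by (auto simp: eval_letter_def)

lemma (in group) eval_word_closed:
  "S \<subseteq> carrier G \<Longrightarrow> w \<in> lists (S \<times> UNIV) \<Longrightarrow> eval_word G w \<in> carrier G"
  by (induction w) (auto simp: eval_word_def eval_letter_def)

lemma (in group) eval_cons_reduced:
  assumes "S \<subseteq> carrier G" "a \<in> S \<times> UNIV" "w \<in> lists (S \<times> UNIV)"
  shows "eval_word G (cons_reduced a w) = eval_letter G a \<otimes> eval_word G w"
proof (cases w)
  case (Cons b v)
  have c: "eval_word G v \<in> carrier G" "fst a \<in> carrier G"
    using assms Cons eval_word_closed by auto
  show ?thesis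
  proof (cases "b = inv_letter a")
    case True
    have "eval_letter G a \<otimes> (eval_letter G (inv_letter a) \<otimes> eval_word G v) = eval_word G v"
      using c by (auto simp: eval_letter_def inv_letter_def m_assoc[symmetric])
    then show ?thesis using True Cons by (simp add: eval_word_def)
  qed (simp add: Cons eval_word_def)
qed (simp add: eval_word_def)

lemma (in group) eval_word_hom:
  assumes "S \<subseteq> carrier G"
  shows "eval_word G \<in> hom (free_group S) G"
proof (rule homI)
  fix u v assume uv: "u \<in> carrier (free_group S)" "v \<in> carrier (free_group S)"
  then have "u \<in> lists (S \<times> UNIV)" "v \<in> lists (S \<times> UNIV)" by (auto simp: free_group_def)
  then have "eval_word G (foldr cons_reduced u v) = eval_word G u \<otimes> eval_word G v"
  proof (induction u rule: list.induct)
    case Nil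
    then show ?case using eval_word_closed[OF assms] by (simp add: eval_word_def)
  next
    case (Cons a u)
    then have m: "a \<in> S \<times> UNIV" "u \<in> lists (S \<times> UNIV)" by auto
    have "eval_word G (foldr cons_reduced (a # u) v)
        = eval_letter G a \<otimes> (eval_word G u \<otimes> eval_word G v)"
      using eval_cons_reduced[OF assms m(1) foldr_in_lists[OF m(2) Cons.prems(2)]]
        Cons.IH[OF m(2) Cons.prems(2)] by simp
    also have "\<dots> = eval_word G (a # u) \<otimes> eval_word G v"
      using eval_letter_closed[OF assms m(1)] eval_word_closed[OF assms m(2)]
        eval_word_closed[OF assms Cons.prems(2)]
      by (simp add: eval_word_def m_assoc)
    finally show ?case .
  qed
  then show "eval_word G (u \<otimes>\<^bsub>free_group S\<^esub> v) = eval_word G u \<otimes> eval_word G v"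
    by (simp add: free_group_def)
qed (use eval_word_closed[OF assms] in \<open>auto simp: free_group_def\<close>)

lemma short_relators_closure_trivial: "short_relators_closure G S (-1) = {\<one>\<^bsub>free_group S\<^esub>}"
proof -
  interpret F: group "free_group S" by (rule group_free_group)
  have "{w \<in> relators G S. int (length w) \<le> -1} = {}" by auto
  moreover have "\<one>\<^bsub>free_group S\<^esub> \<in> H" if "H \<lhd> free_group S" for H
    using that normal_imp_subgroup subgroup.one_closed by blast
  ultimately show ?thesis
    unfolding short_relators_closure_def hull_def using F.one_is_normal by auto
qed


subsection \<open>The word metric\<close>

context group
begin

lemma eval_word_append:
  assumes "S \<subseteq> carrier G" "u \<in> lists (S \<times> UNIV)" "v \<in> lists (S \<times> UNIV)"
  shows "eval_word G (u @ v) = eval_word G u \<otimes> eval_word G v"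
  using assms(2)
proof (induction u rule: list.induct)
  case Nil
  then show ?case using eval_word_closed[OF assms(1,3)] by (simp add: eval_word_def)
next
  case (Cons a u)
  then have m: "a \<in> S \<times> UNIV" "u \<in> lists (S \<times> UNIV)" by auto
  then show ?case
    using Cons.IH[OF m(2)] eval_letter_closed[OF assms(1) m(1)] eval_word_closed[OF assms(1) m(2)]
      eval_word_closed[OF assms(1,3)]
    by (simp add: eval_word_def m_assoc)
qed

lemma eval_word_inverse:
  assumes "S \<subseteq> carrier G" "w \<in> lists (S \<times> UNIV)"
  shows "\<exists>v \<in> lists (S \<times> UNIV). length v = length w \<and> eval_word G v = inv (eval_word G w)"
  using assms(2)
proof (induction w rule: list.induct)
  case Nil
  then show ?case by (simp add: eval_word_def)
next
  case (Cons a w)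
  then have m: "a \<in> S \<times> UNIV" "w \<in> lists (S \<times> UNIV)" by auto
  obtain v where v: "v \<in> lists (S \<times> UNIV)" "length v = length w" "eval_word G v = inv (eval_word G w)"
    using Cons.IH[OF m(2)] by blast
  have s: "fst a \<in> carrier G" using m(1) assms(1) by auto
  have i: "[inv_letter a] \<in> lists (S \<times> UNIV)" using m(1) by (auto simp: inv_letter_def)
  have "eval_word G (v @ [inv_letter a]) = inv (eval_word G w) \<otimes> inv (eval_letter G a)"
    using eval_word_append[OF assms(1) v(1) i] v(3) s
    by (auto simp: eval_word_def eval_letter_def inv_letter_def)
  also have "\<dots> = inv (eval_word G (a # w))"
    using eval_letter_closed[OF assms(1) m(1)] eval_word_closed[OF assms(1) m(2)]
    by (simp add: eval_word_def inv_mult_group)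
  finally have "eval_word G (v @ [inv_letter a]) = inv (eval_word G (a # w))" .
  then show ?case using v i by (intro bexI[of _ "v @ [inv_letter a]"]) auto
qed

lemma eval_word_surj:
  assumes "S \<subseteq> carrier G" "g \<in> generate G S"
  shows "\<exists>w \<in> lists (S \<times> UNIV). eval_word G w = g"
  using assms(2)
proof (induction rule: generate.induct)
  case one
  then show ?case by (intro bexI[of _ "[]"]) (auto simp: eval_word_def)
next
  case (incl h)
  then show ?case using assms(1)
    by (intro bexI[of _ "[(h, True)]"]) (auto simp: eval_word_def eval_letter_def)
next
  case (inv h)
  then show ?case using assms(1)
    by (intro bexI[of _ "[(h, False)]"]) (auto simp: eval_word_def eval_letter_def)
next
  case (eng h1 h2)
  then obtain u v where "u \<in> lists (S \<times> UNIV)" "eval_word G u = h1"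
      "v \<in> lists (S \<times> UNIV)" "eval_word G v = h2" by blast
  then show ?case using eval_word_append[OF assms(1)]
    by (intro bexI[of _ "u @ v"]) (auto simp del: in_lists_conv_set)
qed

lemma word_norm_attained:
  assumes "finite_generating_set G S" "g \<in> carrier G"
  shows "\<exists>w \<in> lists (S \<times> UNIV). length w = word_norm G S g \<and> eval_word G w = g"
proof -
  have "\<exists>k. \<exists>w \<in> lists (S \<times> UNIV). length w = k \<and> eval_word G w = g"
    using eval_word_surj[of S g] assms unfolding finite_generating_set_def by blast
  then show ?thesis unfolding word_norm_def by (rule LeastI_ex)
qed

lemma word_norm_le:
  "w \<in> lists (S \<times> UNIV) \<Longrightarrow> eval_word G w = g \<Longrightarrow> word_norm G S g \<le> length w"
  unfolding word_norm_def by (rule Least_le) blast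

lemma Metric_space_word_dist:
  assumes S: "finite_generating_set G S"
  shows "Metric_space (carrier G) (word_dist G S)"
proof
  have SG: "S \<subseteq> carrier G" using S by (simp add: finite_generating_set_def)
  have le: "word_norm G S (inv g) \<le> word_norm G S g" if "g \<in> carrier G" for g
  proof -
    obtain w where w: "w \<in> lists (S \<times> UNIV)" "length w = word_norm G S g" "eval_word G w = g"
      using word_norm_attained[OF S \<open>g \<in> carrier G\<close>] by blast
    obtain v where "v \<in> lists (S \<times> UNIV)" "length v = length w" "eval_word G v = inv g"
      using eval_word_inverse[OF SG w(1)] w(3) by auto
    then show ?thesis using word_norm_le w(2) by metis
  qed
  show "0 \<le> word_dist G S x y" for x y
    by (simp add: word_dist_def)
  show "word_dist G S x y = word_dist G S y x" for x y
  proof (cases "x \<in> carrier G \<and> y \<in> carrier G")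
    case True
    then have "inv (inv x \<otimes> y) = inv y \<otimes> x" "inv (inv y \<otimes> x) = inv x \<otimes> y"
      by (auto simp: inv_mult_group)
    then show ?thesis using le[of "inv x \<otimes> y"] le[of "inv y \<otimes> x"] True
      by (auto simp: word_dist_def)
  qed (auto simp: word_dist_def)
  show "word_dist G S x y = 0 \<longleftrightarrow> x = y" if xy: "x \<in> carrier G" "y \<in> carrier G" for x y
  proof
    assume "word_dist G S x y = 0"
    then have "word_norm G S (inv x \<otimes> y) = 0" using xy by (simp add: word_dist_def)
    then have "inv x \<otimes> y = \<one>"
      using word_norm_attained[OF S, of "inv x \<otimes> y"] xy by (auto simp: eval_word_def)
    then show "x = y" using xy by (metis inv_closed inv_equality inv_inv)
  next
    assume "x = y"
    moreover have "word_norm G S \<one> = 0"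
      using word_norm_le[of "[]" S \<one>] by (simp add: eval_word_def)
    ultimately show "word_dist G S x y = 0" using xy by (simp add: word_dist_def)
  qed
  show "word_dist G S x z \<le> word_dist G S x y + word_dist G S y z"
    if xyz: "x \<in> carrier G" "y \<in> carrier G" "z \<in> carrier G" for x y z
  proof -
    have "inv x \<otimes> y \<in> carrier G" "inv y \<otimes> z \<in> carrier G" using xyz by auto
    then obtain u v where
      u: "u \<in> lists (S \<times> UNIV)" "length u = word_norm G S (inv x \<otimes> y)" "eval_word G u = inv x \<otimes> y"
      and v: "v \<in> lists (S \<times> UNIV)" "length v = word_norm G S (inv y \<otimes> z)" "eval_word G v = inv y \<otimes> z"
      using word_norm_attained[OF S] by metis
    have "y \<otimes> (inv y \<otimes> z) = z" using xyz by (simp add: m_assoc[symmetric])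
    then have "eval_word G (u @ v) = inv x \<otimes> z"
      using eval_word_append[OF SG u(1) v(1)] u(3) v(3) xyz by (simp add: m_assoc)
    moreover have "u @ v \<in> lists (S \<times> UNIV)" using u(1) v(1) by (simp del: in_lists_conv_set)
    ultimately have "word_norm G S (inv x \<otimes> z) \<le> length (u @ v)" by (rule word_norm_le[rotated])
    then show ?thesis using u(2) v(2) xyz by (simp add: word_dist_def)
  qed
qed

end


subsection \<open>Ultralimits\<close>

lemma ultrafilter_bounded_convergent:
  fixes f :: "'a \<Rightarrow> real"
  assumes "ultrafilter \<omega>" "eventually (\<lambda>n. \<bar>f n\<bar> \<le> C) \<omega>"
  shows "\<exists>r. (f \<longlongrightarrow> r) \<omega>"
proof -
  have nb: "filtermap f \<omega> \<noteq> bot" using assms(1) by (simp add: ultrafilter_def filtermap_bot_iff)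
  have "eventually (\<lambda>r. r \<in> {-C..C}) (filtermap f \<omega>)"
    using assms(2) unfolding eventually_filtermap by eventually_elim auto
  then obtain r where r: "inf (nhds r) (filtermap f \<omega>) \<noteq> bot"
    using compact_Icc[of "-C" C] nb unfolding compact_filter by blast
  have "eventually (\<lambda>n. f n \<in> U) \<omega>" if U: "open U" "r \<in> U" for U
  proof (rule ccontr)
    assume "\<not> eventually (\<lambda>n. f n \<in> U) \<omega>"
    then have "eventually (\<lambda>n. f n \<notin> U) \<omega>" using assms(1) by (auto simp: ultrafilter_def)
    then have "eventually (\<lambda>y. y \<notin> U) (filtermap f \<omega>)" by (simp add: eventually_filtermap)
    moreover have "eventually (\<lambda>y. y \<in> U) (nhds r)" using U by (rule eventually_nhds_in_open)
    ultimately have "eventually (\<lambda>y. False) (inf (nhds r) (filtermap f \<omega>))"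
      unfolding eventually_inf by blast
    with r show False by (simp add: trivial_limit_def)
  qed
  then show ?thesis by (auto simp: tendsto_def)
qed

context
  fixes \<omega> :: "nat filter" and M :: "nat \<Rightarrow> 'a set" and d :: "nat \<Rightarrow> 'a \<Rightarrow> 'a \<Rightarrow> real"
    and x :: "nat \<Rightarrow> 'a"
  assumes uf: "ultrafilter \<omega>" and ms: "\<And>n. Metric_space (M n) (d n)" and x: "\<And>n. x n \<in> M n"
begin

lemma ultralimit_nontrivial: "\<omega> \<noteq> bot"
  using uf by (simp add: ultrafilter_def)

lemma bounded_seqs_convergent:
  assumes "y \<in> bounded_seqs \<omega> M d x" "z \<in> bounded_seqs \<omega> M d x"
  shows "\<exists>r. ((\<lambda>n. d n (y n) (z n)) \<longlongrightarrow> r) \<omega>"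
proof -
  obtain C D where y: "\<And>n. y n \<in> M n" "eventually (\<lambda>n. d n (x n) (y n) \<le> C) \<omega>"
    and z: "\<And>n. z n \<in> M n" "eventually (\<lambda>n. d n (x n) (z n) \<le> D) \<omega>"
    using assms by (auto simp: bounded_seqs_def)
  have "eventually (\<lambda>n. \<bar>d n (y n) (z n)\<bar> \<le> C + D) \<omega>"
    using y(2) z(2)
  proof eventually_elim
    case (elim n)
    have "d n (y n) (z n) \<le> d n (x n) (y n) + d n (x n) (z n)"
      using Metric_space.triangle[OF ms y(1) x z(1)] Metric_space.commute[OF ms, of n "y n" "x n"]
      by metis
    then show ?case using elim Metric_space.nonneg[OF ms, of n "y n" "z n"] by simp
  qed
  then show ?thesis by (rule ultrafilter_bounded_convergent[OF uf])
qed

lemma equiv_asymp_seqs: "equiv (bounded_seqs \<omega> M d x) (asymp_seqs \<omega> M d x)"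
proof (rule equivI)
  show "asymp_seqs \<omega> M d x \<subseteq> bounded_seqs \<omega> M d x \<times> bounded_seqs \<omega> M d x"
    by (auto simp: asymp_seqs_def)
  show "refl_on (bounded_seqs \<omega> M d x) (asymp_seqs \<omega> M d x)"
  proof (rule refl_onI)
    fix y assume y: "y \<in> bounded_seqs \<omega> M d x"
    then have "y n \<in> M n" for n by (simp add: bounded_seqs_def)
    then have "d n (y n) (y n) = 0" for n using Metric_space.zero[OF ms] by blast
    then show "(y, y) \<in> asymp_seqs \<omega> M d x" using y by (simp add: asymp_seqs_def)
  qed
  show "sym (asymp_seqs \<omega> M d x)"
    using Metric_space.commute[OF ms] by (auto simp: sym_def asymp_seqs_def)
  show "trans (asymp_seqs \<omega> M d x)"
  proof (rule transI)
    fix u v w assume uv: "(u, v) \<in> asymp_seqs \<omega> M d x" and vw: "(v, w) \<in> asymp_seqs \<omega> M d x"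
    then have m: "u n \<in> M n" "v n \<in> M n" "w n \<in> M n" for n
      by (auto simp: asymp_seqs_def bounded_seqs_def)
    have lim: "((\<lambda>n. d n (u n) (v n) + d n (v n) (w n)) \<longlongrightarrow> 0) \<omega>"
      using uv vw tendsto_add[of _ 0 _ _ 0] by (fastforce simp: asymp_seqs_def)
    have "((\<lambda>n. d n (u n) (w n)) \<longlongrightarrow> 0) \<omega>"
    proof (rule tendsto_sandwich[OF _ _ tendsto_const lim])
      show "eventually (\<lambda>n. 0 \<le> d n (u n) (w n)) \<omega>"
        by (simp add: Metric_space.nonneg[OF ms])
      show "eventually (\<lambda>n. d n (u n) (w n) \<le> d n (u n) (v n) + d n (v n) (w n)) \<omega>"
        using Metric_space.triangle[OF ms m(1) m(2) m(3)] by simp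
    qed
    then show "(u, w) \<in> asymp_seqs \<omega> M d x" using uv vw by (auto simp: asymp_seqs_def)
  qed
qed

lemma asymp_seqs_same_limit:
  assumes "(y, y') \<in> asymp_seqs \<omega> M d x" "(z, z') \<in> asymp_seqs \<omega> M d x"
    and r: "((\<lambda>n. d n (y n) (z n)) \<longlongrightarrow> r) \<omega>"
  shows "((\<lambda>n. d n (y' n) (z' n)) \<longlongrightarrow> r) \<omega>"
proof -
  have m: "y n \<in> M n" "y' n \<in> M n" "z n \<in> M n" "z' n \<in> M n" for n
    using assms(1,2) by (auto simp: asymp_seqs_def bounded_seqs_def)
  have lim: "((\<lambda>n. d n (y n) (y' n) + d n (z n) (z' n)) \<longlongrightarrow> 0) \<omega>"
    using assms(1,2) tendsto_add[of _ 0 _ _ 0] by (fastforce simp: asymp_seqs_def)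
  have "\<bar>d n (y' n) (z' n) - d n (y n) (z n)\<bar> \<le> d n (y n) (y' n) + d n (z n) (z' n)" for n
  proof -
    interpret Metric_space "M n" "d n" by (rule ms)
    show ?thesis
      using triangle[OF m(2) m(1) m(4)] triangle[OF m(1) m(3) m(4)]
        triangle[OF m(1) m(2) m(3)] triangle[OF m(2) m(4) m(3)]
        commute[of "y n" "y' n"] commute[of "z n" "z' n"]
      by linarith
  qed
  then have "((\<lambda>n. d n (y' n) (z' n) - d n (y n) (z n)) \<longlongrightarrow> 0) \<omega>"
    by (intro Lim_null_comparison[OF _ lim]) (simp add: always_eventually)
  from tendsto_add[OF this r] show ?thesis by simp
qed

lemma ultralimit_dist_eq:
  assumes A: "A \<in> ultralimit_points \<omega> M d x" and B: "B \<in> ultralimit_points \<omega> M d x"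
    and "y \<in> A" "z \<in> B"
    and r: "((\<lambda>n. d n (y n) (z n)) \<longlongrightarrow> r) \<omega>"
  shows "ultralimit_dist \<omega> M d x A B = r"
proof -
  have "(THE r. \<exists>y\<in>A. \<exists>z\<in>B. ((\<lambda>n. d n (y n) (z n)) \<longlongrightarrow> r) \<omega>) = r"
  proof (rule the_equality)
    fix r' assume "\<exists>y\<in>A. \<exists>z\<in>B. ((\<lambda>n. d n (y n) (z n)) \<longlongrightarrow> r') \<omega>"
    then obtain y' z' where y'z': "y' \<in> A" "z' \<in> B" "((\<lambda>n. d n (y' n) (z' n)) \<longlongrightarrow> r') \<omega>" by blast
    have "(y, y') \<in> asymp_seqs \<omega> M d x" "(z, z') \<in> asymp_seqs \<omega> M d x"
      using A B assms(3,4) y'z' quotient_eq_iff[OF equiv_asymp_seqs]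
      unfolding ultralimit_points_def by blast+
    from asymp_seqs_same_limit[OF this r] show "r' = r"
      using y'z'(3) tendsto_unique[OF ultralimit_nontrivial] by blast
  qed (use assms in blast)
  then show ?thesis using A B by (simp add: ultralimit_dist_def)
qed

lemma Metric_space_ultralimit:
  "Metric_space (ultralimit_points \<omega> M d x) (ultralimit_dist \<omega> M d x)"
proof -
  let ?P = "ultralimit_points \<omega> M d x" and ?D = "ultralimit_dist \<omega> M d x"
  have rep: "\<exists>y. y \<in> A \<and> y \<in> bounded_seqs \<omega> M d x \<and> (\<forall>n. y n \<in> M n)" if "A \<in> ?P" for A
    using that equiv_class_self[OF equiv_asymp_seqs]
    unfolding ultralimit_points_def by (auto elim!: quotientE simp: bounded_seqs_def)
  have lim: "((\<lambda>n. d n (y n) (z n)) \<longlongrightarrow> ?D A B) \<omega>"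
    if "A \<in> ?P" "B \<in> ?P" "y \<in> A" "z \<in> B" for A B y z
  proof -
    have "y \<in> bounded_seqs \<omega> M d x" "z \<in> bounded_seqs \<omega> M d x"
      using that in_quotient_imp_subset[OF equiv_asymp_seqs] unfolding ultralimit_points_def
      by blast+
    then obtain r where "((\<lambda>n. d n (y n) (z n)) \<longlongrightarrow> r) \<omega>" using bounded_seqs_convergent by blast
    then show ?thesis using ultralimit_dist_eq[OF that] by simp
  qed
  show ?thesis
  proof
    show "0 \<le> ?D A B" for A B
    proof (cases "A \<in> ?P \<and> B \<in> ?P")
      case True
      then obtain y z where yz: "y \<in> A" "z \<in> B" using rep[of A] rep[of B] by auto
      have "eventually (\<lambda>n. 0 \<le> d n (y n) (z n)) \<omega>" by (simp add: Metric_space.nonneg[OF ms])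
      then show ?thesis
        by (rule tendsto_lowerbound[OF lim[OF conjunct1[OF True] conjunct2[OF True] yz] _
              ultralimit_nontrivial])
    qed (auto simp: ultralimit_dist_def)
    show "?D A B = ?D B A" for A B
    proof (cases "A \<in> ?P \<and> B \<in> ?P")
      case True
      then obtain y z where yz: "y \<in> A" "z \<in> B" using rep[of A] rep[of B] by auto
      have "((\<lambda>n. d n (y n) (z n)) \<longlongrightarrow> ?D B A) \<omega>"
        using lim[of B A z y] True yz Metric_space.commute[OF ms] by simp
      then show ?thesis
        by (rule ultralimit_dist_eq[OF conjunct1[OF True] conjunct2[OF True] yz])
    qed (auto simp: ultralimit_dist_def)
    show "?D A B = 0 \<longleftrightarrow> A = B" if AB: "A \<in> ?P" "B \<in> ?P" for A B
    proof -
      obtain y z where y: "y \<in> A" "y \<in> bounded_seqs \<omega> M d x" "\<forall>n. y n \<in> M n"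
        and z: "z \<in> B" "z \<in> bounded_seqs \<omega> M d x" using rep[OF AB(1)] rep[OF AB(2)] by auto
      have "A = B \<longleftrightarrow> (y, z) \<in> asymp_seqs \<omega> M d x"
        using quotient_eq_iff[OF equiv_asymp_seqs _ _ y(1) z(1)] AB
        unfolding ultralimit_points_def by simp
      also have "\<dots> \<longleftrightarrow> ((\<lambda>n. d n (y n) (z n)) \<longlongrightarrow> 0) \<omega>"
        using y z by (simp add: asymp_seqs_def)
      also have "\<dots> \<longleftrightarrow> ?D A B = 0"
        using lim[OF AB y(1) z(1)] ultralimit_dist_eq[OF AB y(1) z(1), of 0] by auto
      finally show ?thesis by simp
    qed
    show "?D A C \<le> ?D A B + ?D B C" if ABC: "A \<in> ?P" "B \<in> ?P" "C \<in> ?P" for A B C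
    proof -
      obtain u v w where u: "u \<in> A" "\<forall>n. u n \<in> M n" and v: "v \<in> B" "\<forall>n. v n \<in> M n"
        and w: "w \<in> C" "\<forall>n. w n \<in> M n" using rep[OF ABC(1)] rep[OF ABC(2)] rep[OF ABC(3)] by auto
      show ?thesis
      proof (rule tendsto_le[OF ultralimit_nontrivial])
        show "((\<lambda>n. d n (u n) (w n)) \<longlongrightarrow> ?D A C) \<omega>" by (rule lim[OF ABC(1,3) u(1) w(1)])
        show "((\<lambda>n. d n (u n) (v n) + d n (v n) (w n)) \<longlongrightarrow> ?D A B + ?D B C) \<omega>"
          by (intro tendsto_add lim[OF ABC(1,2) u(1) v(1)] lim[OF ABC(2,3) v(1) w(1)])
        show "eventually (\<lambda>n. d n (u n) (w n) \<le> d n (u n) (v n) + d n (v n) (w n)) \<omega>"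
          using Metric_space.triangle[OF ms] u v w by simp
      qed
    qed
  qed
qed

end

lemma Metric_space_cone:
  assumes "group G" "finite_generating_set G S" "ultrafilter \<omega>"
    and "\<And>n. x n \<in> carrier G" "\<And>n. s n > 0"
  shows "Metric_space (cone_points G S \<omega> x s) (cone_dist G S \<omega> x s)"
proof -
  interpret Metric_space "carrier G" "word_dist G S"
    by (rule group.Metric_space_word_dist[OF assms(1,2)])
  have "Metric_space (carrier G) (\<lambda>g h. word_dist G S g h / s n)" for n
  proof
    show "word_dist G S g k / s n \<le> word_dist G S g h / s n + word_dist G S h k / s n"
      if "g \<in> carrier G" "h \<in> carrier G" "k \<in> carrier G" for g h k
      using triangle[OF that] assms(5)[of n] by (simp add: add_divide_distrib[symmetric] divide_right_mono)
    show "word_dist G S g h / s n = 0 \<longleftrightarrow> g = h" if "g \<in> carrier G" "h \<in> carrier G" for g h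
      using zero[OF that] assms(5)[of n] by simp
  qed (use assms(5) commute in \<open>auto simp: less_imp_le\<close>)
  from Metric_space_ultralimit[OF assms(3) this] assms(4) show ?thesis
    by (simp add: cone_points_def cone_dist_def)
qed

end

theory Submission
  imports Defs
begin

text \<open>
  Let \<open>T\<close> be a finite generating set witnessing dense relatedness. For every \<open>n\<close> there is a relator
  \<open>w\<^sub>n\<close> over \<open>T\<close> whose length is comparable to \<open>s\<^sub>n\<close> and that does not follow from shorter relators.
  The rescaled loops that read \<open>w\<^sub>n\<close> from \<open>x\<^sub>n\<close> converge to a Lipschitz loop in the cone. A null homotopy
  of this loop, restricted to a fine finite grid, lifts for \<open>\<omega>\<close>-almost all \<open>n\<close> to a grid in \<open>G\<close> whose
  neighbouring points are at \<open>T\<close>-distance at most one fifth of the length of \<open>w\<^sub>n\<close>. The boundaries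
  of the grid squares are then relators shorter than \<open>w\<^sub>n\<close>, and \<open>w\<^sub>n\<close> is a consequence of them: a
  contradiction. Word norms for different finite generating sets are bi-Lipschitz equivalent, so the
  cone may be taken with respect to another generating set \<open>S\<close>.
\<close>

section \<open>Words and cosets\<close>

definition inv_word :: "'a word \<Rightarrow> 'a word" where
  "inv_word w = rev (map inv_letter w)"

lemma length_inv_word [simp]: "length (inv_word w) = length w"
  by (simp add: inv_word_def)

lemma inv_word_in_lists: "w \<in> lists (S \<times> UNIV) \<Longrightarrow> inv_word w \<in> lists (S \<times> UNIV)"
  by (fastforce simp: inv_word_def inv_letter_def)

text \<open>Words read along paths in a grid are concatenated freely and need not be reduced. This
  is the projection from arbitrary words to the elements of the free group.\<close>

definition reduce :: "'a word \<Rightarrow> 'a word" where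
  "reduce w = foldr cons_reduced w []"

lemma reduced_reduce: "reduced_word (reduce w)"
  by (simp add: reduce_def reduced_foldr)

lemma reduce_reduced: "reduced_word w \<Longrightarrow> reduce w = w"
  by (simp add: reduce_def foldr_cons_reduced_Nil)

lemma reduce_closed: "w \<in> lists (S \<times> UNIV) \<Longrightarrow> reduce w \<in> carrier (free_group S)"
  using foldr_in_lists[of w S "[]"] reduced_reduce[of w]
  by (simp add: free_group_def reduce_def del: in_lists_conv_set)

lemma length_reduce: "length (reduce w) \<le> length w"
proof (induction w)
  case (Cons a w)
  have "length (cons_reduced a v) \<le> Suc (length v)" for v
    by (cases v) auto
  from this[of "reduce w"] Cons show ?case by (simp add: reduce_def)
qed (simp add: reduce_def)

text \<open>The multiplication of \<open>free_group S\<close> is the same function for all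
  \<open>S\<close>, so \<open>S\<close> is free on the right and has to be instantiated when
  rewriting from left to right.\<close>

lemma reduce_append: "reduce (u @ v) = reduce u \<otimes>\<^bsub>free_group S\<^esub> reduce v"
  using foldr_cons_reduced_assoc[OF reduced_reduce, of u "[]" v]
  by (simp add: reduce_def free_group_def)

lemma reduce_inv_word: "reduce (inv_word w @ w) = []"
proof (induction w)
  case (Cons a w)
  have "cons_reduced (inv_letter a) (cons_reduced a (reduce w)) = reduce w"
    using cons_reduced_inv[OF reduced_reduce, of "inv_letter a" w] by simp
  with Cons show ?case by (simp add: reduce_def inv_word_def)
qed (simp add: reduce_def inv_word_def)

context group
begin

lemma eval_reduce:
  assumes "S \<subseteq> carrier G" "w \<in> lists (S \<times> UNIV)"
  shows "eval_word G (reduce w) = eval_word G w"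
  using assms(2)
proof (induction w rule: list.induct)
  case (Cons a w)
  then have m: "a \<in> S \<times> UNIV" "w \<in> lists (S \<times> UNIV)" by auto
  then have "reduce w \<in> lists (S \<times> UNIV)"
    using reduce_closed[OF m(2)] by (simp add: free_group_def del: in_lists_conv_set)
  then show ?case
    using eval_cons_reduced[OF assms(1) m(1)] Cons.IH[OF m(2)]
    by (simp add: reduce_def eval_word_def)
qed (simp add: reduce_def eval_word_def)

lemma eval_inv_word:
  assumes "S \<subseteq> carrier G" "w \<in> lists (S \<times> UNIV)"
  shows "eval_word G (inv_word w) = inv (eval_word G w)"
proof -
  have c: "eval_word G (inv_word w) \<in> carrier G" "eval_word G w \<in> carrier G"
    using assms eval_word_closed inv_word_in_lists by blast+
  have "eval_word G (inv_word w) \<otimes> eval_word G w = eval_word G (inv_word w @ w)"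
    using eval_word_append[OF assms(1) inv_word_in_lists[OF assms(2)] assms(2)] by simp
  also have "\<dots> = eval_word G (reduce (inv_word w @ w))"
    using eval_reduce[OF assms(1), of "inv_word w @ w"] assms(2) inv_word_in_lists[OF assms(2)]
    by (simp del: in_lists_conv_set)
  also have "\<dots> = \<one>" by (simp add: reduce_inv_word eval_word_def)
  finally show ?thesis using c by (metis inv_equality)
qed

text \<open>Two paths with common endpoints bound a loop, read by \<open>u @ inv_word v\<close>. Its
  reduction is a relator of length below \<open>m\<close>, so it lies in \<open>H\<close>, and
  multiplying it by \<open>reduce v\<close> gives back \<open>reduce u\<close>. Below, the two paths
  are the two ways around a grid square.\<close>

lemma rcoset_reduce_eqI:
  assumes SG: "S \<subseteq> carrier G" and H: "H \<lhd> free_group S"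
    and short: "{w \<in> relators G S. length w < m} \<subseteq> H"
    and u: "u \<in> lists (S \<times> UNIV)" and v: "v \<in> lists (S \<times> UNIV)"
    and ev: "eval_word G u = eval_word G v" and len: "length u + length v < m"
  shows "H #>\<^bsub>free_group S\<^esub> reduce u = H #>\<^bsub>free_group S\<^esub> reduce v"
proof -
  interpret H: normal H "free_group S" by (rule H)
  let ?r = "u @ inv_word v"
  have r: "?r \<in> lists (S \<times> UNIV)"
    using u inv_word_in_lists[OF v] by (simp del: in_lists_conv_set)
  have "eval_word G (reduce ?r) = eval_word G v \<otimes> inv (eval_word G v)"
    using eval_reduce[OF SG r] eval_word_append[OF SG u inv_word_in_lists[OF v]]
      eval_inv_word[OF SG v] ev by simp
  then have "reduce ?r \<in> relators G S"
    using eval_word_closed[OF SG v] reduce_closed[OF r] by (simp add: relators_def kernel_def)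
  moreover have "length (reduce ?r) < m" using length_reduce[of ?r] len by simp
  ultimately have rH: "reduce ?r \<in> H" using short by blast
  have "reduce u = reduce u \<otimes>\<^bsub>free_group S\<^esub> reduce (inv_word v @ v)"
    using reduced_reduce[of u] by (simp add: reduce_inv_word free_group_def foldr_cons_reduced_Nil)
  also have "\<dots> = reduce ?r \<otimes>\<^bsub>free_group S\<^esub> reduce v"
    by (simp add: reduce_append[symmetric])
  finally have "H #>\<^bsub>free_group S\<^esub> reduce u
      = (H #>\<^bsub>free_group S\<^esub> reduce ?r) #>\<^bsub>free_group S\<^esub> reduce v"
    using H.coset_mult_assoc[OF H.subset reduce_closed[OF r] reduce_closed[OF v]] by simp
  then show ?thesis
    using H.coset_join2[OF reduce_closed[OF r] H.subgroup_axioms rH] by simp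
qed

end

text \<open>Normality makes the coset of a concatenation depend only on the cosets of its pieces.
  This supplies the congruence hypothesis of \<open>commuting_squares_rows\<close>.\<close>

lemma rcoset_reduce_append:
  assumes "H \<lhd> free_group S" "u \<in> lists (S \<times> UNIV)" "v \<in> lists (S \<times> UNIV)"
  shows "H #>\<^bsub>free_group S\<^esub> reduce (u @ v)
    = (H #>\<^bsub>free_group S\<^esub> reduce u) <#>\<^bsub>free_group S\<^esub> (H #>\<^bsub>free_group S\<^esub> reduce v)"
  using normal.rcos_sum[OF assms(1) reduce_closed[OF assms(2)] reduce_closed[OF assms(3)]]
  by (simp add: reduce_append[where S = S])

section \<open>Discrete homotopies\<close>

lemma concat_map_upt_in_lists:
  "(\<And>j. j < k \<Longrightarrow> a j \<in> lists A) \<Longrightarrow> concat (map a [0..<k]) \<in> lists A"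
  by (induction k) (simp_all del: in_lists_conv_set)

text \<open>A strip of squares has top edges \<open>a j\<close>, bottom edges \<open>a' j\<close>
  and vertical edges \<open>b j\<close>. The vertical edge at the right end is pushed leftwards
  through the strip, each square replacing \<open>a j @ b (Suc j)\<close> by
  \<open>b j @ a' j\<close>.\<close>

lemma commuting_squares_rows:
  fixes \<phi> :: "'l list \<Rightarrow> 'm"
  assumes cong: "\<And>u u' v v'. \<lbrakk>u \<in> lists A; u' \<in> lists A; v \<in> lists A; v' \<in> lists A;
      \<phi> u = \<phi> u'; \<phi> v = \<phi> v'\<rbrakk> \<Longrightarrow> \<phi> (u @ v) = \<phi> (u' @ v')"
    and words: "\<And>j. j < k \<Longrightarrow> a j \<in> lists A" "\<And>j. j < k \<Longrightarrow> a' j \<in> lists A"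
      "\<And>j. j \<le> k \<Longrightarrow> b j \<in> lists A"
    and squares: "\<And>j. j < k \<Longrightarrow> \<phi> (a j @ b (Suc j)) = \<phi> (b j @ a' j)"
  shows "\<phi> (concat (map a [0..<k]) @ b k) = \<phi> (b 0 @ concat (map a' [0..<k]))"
  using words squares
proof (induction k)
  case (Suc k)
  let ?R = "concat (map a [0..<k])" and ?R' = "concat (map a' [0..<k])"
  have R: "?R \<in> lists A" "?R' \<in> lists A"
    by (rule concat_map_upt_in_lists, use Suc.prems in simp)+
  have m: "a k \<in> lists A" "a' k \<in> lists A" "b k \<in> lists A" "b (Suc k) \<in> lists A" "b 0 \<in> lists A"
    using Suc.prems(1-3) by (simp_all del: in_lists_conv_set)
  have IH: "\<phi> (?R @ b k) = \<phi> (b 0 @ ?R')"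
    by (rule Suc.IH) (use Suc.prems in \<open>simp_all del: in_lists_conv_set\<close>)
  have "\<phi> (?R @ (a k @ b (Suc k))) = \<phi> (?R @ (b k @ a' k))"
    by (rule cong) (use R m Suc.prems(4)[of k] in \<open>simp_all del: in_lists_conv_set\<close>)
  also have "\<dots> = \<phi> ((?R @ b k) @ a' k)" by simp
  also have "\<dots> = \<phi> ((b 0 @ ?R') @ a' k)"
    by (rule cong) (use R m IH in \<open>simp_all del: in_lists_conv_set\<close>)
  finally show ?case by simp
qed simp

lemma concat_take_segments:
  assumes "t 0 = 0" "\<And>j. j < k \<Longrightarrow> t j \<le> t (Suc j)"
  shows "concat (map (\<lambda>j. take (t (Suc j) - t j) (drop (t j) w)) [0..<k]) = take (t k) w"
  using assms(2)
proof (induction k)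
  case (Suc k)
  have "take (t k) w @ take (t (Suc k) - t k) (drop (t k) w) = take (t (Suc k)) w"
    using take_add[of "t k" "t (Suc k) - t k" w] Suc.prems[of k] by simp
  with Suc show ?case by simp
qed (simp add: assms(1))

context group
begin

text \<open>A combinatorial van Kampen argument. Row 0 of the grid reads \<open>w\<close> from
  \<open>g\<close>, the other three sides are constant, and each square has perimeter at most
  \<open>4 * \<delta>\<close>, which is less than the length of \<open>w\<close>. Modulo a normal
  subgroup containing all shorter relators, consecutive rows read the same element, so
  \<open>w\<close> equals the empty word of the last row.\<close>

lemma fine_filling_in_short_relators_closure:
  assumes S: "finite_generating_set G S" and w: "w \<in> relators G S" and g: "g \<in> carrier G"
    and y: "\<And>i j. i \<le> K \<Longrightarrow> j \<le> K \<Longrightarrow> y i j \<in> carrier G"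
    and first: "\<And>j. j \<le> K \<Longrightarrow> y 0 j = g \<otimes> eval_word G (take (t j) w)"
    and bdry: "\<And>j. j \<le> K \<Longrightarrow> y K j = g" "\<And>i. i \<le> K \<Longrightarrow> y i 0 = g" "\<And>i. i \<le> K \<Longrightarrow> y i K = g"
    and t: "t 0 = 0" "t K = length w"
      "\<And>j. j < K \<Longrightarrow> t j \<le> t (Suc j)" "\<And>j. j < K \<Longrightarrow> t (Suc j) \<le> t j + \<delta>"
    and hor: "\<And>i j. i \<le> K \<Longrightarrow> j < K \<Longrightarrow> word_norm G S (inv (y i j) \<otimes> y i (Suc j)) \<le> \<delta>"
    and ver: "\<And>i j. i < K \<Longrightarrow> j \<le> K \<Longrightarrow> word_norm G S (inv (y i j) \<otimes> y (Suc i) j) \<le> \<delta>"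
    and \<delta>: "4 * \<delta> < length w"
  shows "w \<in> short_relators_closure G S (int (length w) - 1)"
proof -
  have SG: "S \<subseteq> carrier G" using S by (simp add: finite_generating_set_def)
  have wl: "w \<in> lists (S \<times> UNIV)" and wr: "reduced_word w" and wF: "w \<in> carrier (free_group S)"
    using w by (auto simp: relators_def kernel_def free_group_def)
  have tw: "take n w \<in> lists (S \<times> UNIV)" "drop n w \<in> lists (S \<times> UNIV)" for n
    using wl by (auto dest: in_set_takeD in_set_dropD)
  \<comment> \<open>For \<open>K = 0\<close> the word \<open>w\<close> would be empty, against
    \<open>4 * \<delta> < length w\<close>. Hence the first and last rows differ, and the labels
    prescribed on them below cannot conflict.\<close>
  have K: "K > 0" using t(1,2) \<delta> by (cases K) auto
  have step: "y i j \<otimes> (inv (y i j) \<otimes> h) = h"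
    if "i \<le> K" "j \<le> K" "h \<in> carrier G" for i j h
    using that y by (simp add: m_assoc[symmetric])
  \<comment> \<open>\<open>A\<close> and \<open>B\<close> describe admissible labels of horizontal
    and vertical edges. Interior edges may carry any shortest word. On the boundary the labels are
    prescribed as words, since row 0 must spell \<open>w\<close> itself and not merely a word with
    the same value.\<close>
  define A where "A i j u \<longleftrightarrow> length u \<le> \<delta> \<and> eval_word G u = inv (y i j) \<otimes> y i (Suc j) \<and>
      (i = 0 \<longrightarrow> u = take (t (Suc j) - t j) (drop (t j) w)) \<and> (i = K \<longrightarrow> u = [])" for i j u
  define B where "B i j u \<longleftrightarrow> length u \<le> \<delta> \<and> eval_word G u = inv (y i j) \<otimes> y (Suc i) j \<and>
      (j = 0 \<or> j = K \<longrightarrow> u = [])" for i j u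
  have "\<exists>u \<in> lists (S \<times> UNIV). A i j u" if ij: "i \<le> K" "j < K" for i j
  proof (cases "i = 0 \<or> i = K")
    case False
    obtain u where "u \<in> lists (S \<times> UNIV)" "length u = word_norm G S (inv (y i j) \<otimes> y i (Suc j))"
        "eval_word G u = inv (y i j) \<otimes> y i (Suc j)"
      using word_norm_attained[OF S, of "inv (y i j) \<otimes> y i (Suc j)"] y ij by auto
    with False hor[OF ij] show ?thesis by (intro bexI[of _ u]) (auto simp: A_def)
  next
    case True
    then show ?thesis
    proof
      assume i: "i = 0"
      let ?u = "take (t (Suc j) - t j) (drop (t j) w)"
      have ul: "?u \<in> lists (S \<times> UNIV)"
        using tw(2)[of "t j"] by (auto dest: in_set_takeD)
      have "take (t (Suc j)) w = take (t j) w @ ?u"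
        using take_add[of "t j" "t (Suc j) - t j" w] t(3)[OF ij(2)] by simp
      then have "y 0 (Suc j) = y 0 j \<otimes> eval_word G ?u"
        using first[of j] first[of "Suc j"] ij g eval_word_append[OF SG tw(1) ul]
          eval_word_closed[OF SG ul] eval_word_closed[OF SG tw(1)]
        by (simp add: m_assoc)
      then have "eval_word G ?u = inv (y 0 j) \<otimes> y 0 (Suc j)"
        using y[of 0 j] ij eval_word_closed[OF SG ul] by (simp add: m_assoc[symmetric])
      moreover have "length ?u \<le> \<delta>" using t(4)[OF ij(2)] by simp
      ultimately show ?thesis using ul i K by (intro bexI[of _ ?u]) (auto simp: A_def)
    next
      assume i: "i = K"
      have "eval_word G [] = inv (y K j) \<otimes> y K (Suc j)"
        using bdry(1)[of j] bdry(1)[of "Suc j"] ij g by (simp add: eval_word_def)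
      then show ?thesis using i K by (intro bexI[of _ "[]"]) (auto simp: A_def)
    qed
  qed
  then obtain a where "\<forall>i j. i \<le> K \<longrightarrow> j < K \<longrightarrow> a i j \<in> lists (S \<times> UNIV) \<and> A i j (a i j)"
    by metis
  then have a: "\<And>i j. i \<le> K \<Longrightarrow> j < K \<Longrightarrow> a i j \<in> lists (S \<times> UNIV)"
      "\<And>i j. i \<le> K \<Longrightarrow> j < K \<Longrightarrow> length (a i j) \<le> \<delta>"
      "\<And>i j. i \<le> K \<Longrightarrow> j < K \<Longrightarrow> eval_word G (a i j) = inv (y i j) \<otimes> y i (Suc j)"
      "\<And>j. j < K \<Longrightarrow> a 0 j = take (t (Suc j) - t j) (drop (t j) w)"
      "\<And>j. j < K \<Longrightarrow> a K j = []"
    unfolding A_def by blast+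
  have "\<exists>u \<in> lists (S \<times> UNIV). B i j u" if ij: "i < K" "j \<le> K" for i j
  proof (cases "j = 0 \<or> j = K")
    case False
    obtain u where "u \<in> lists (S \<times> UNIV)" "length u = word_norm G S (inv (y i j) \<otimes> y (Suc i) j)"
        "eval_word G u = inv (y i j) \<otimes> y (Suc i) j"
      using word_norm_attained[OF S, of "inv (y i j) \<otimes> y (Suc i) j"] y ij by auto
    with False ver[OF ij] show ?thesis by (intro bexI[of _ u]) (auto simp: B_def)
  next
    case True
    then have "eval_word G [] = inv (y i j) \<otimes> y (Suc i) j"
      using bdry(2,3)[of i] bdry(2,3)[of "Suc i"] ij g by (auto simp: eval_word_def)
    then show ?thesis by (intro bexI[of _ "[]"]) (auto simp: B_def)
  qed
  then obtain b where "\<forall>i j. i < K \<longrightarrow> j \<le> K \<longrightarrow> b i j \<in> lists (S \<times> UNIV) \<and> B i j (b i j)"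
    by metis
  then have b: "\<And>i j. i < K \<Longrightarrow> j \<le> K \<Longrightarrow> b i j \<in> lists (S \<times> UNIV)"
      "\<And>i j. i < K \<Longrightarrow> j \<le> K \<Longrightarrow> length (b i j) \<le> \<delta>"
      "\<And>i j. i < K \<Longrightarrow> j \<le> K \<Longrightarrow> eval_word G (b i j) = inv (y i j) \<otimes> y (Suc i) j"
      "\<And>i. i < K \<Longrightarrow> b i 0 = []" "\<And>i. i < K \<Longrightarrow> b i K = []"
    unfolding B_def by blast+
  \<comment> \<open>The hull is the intersection of all such \<open>H\<close>, so each
    \<open>H\<close> is treated separately.\<close>
  have "w \<in> H" if H: "H \<lhd> free_group S"
    and sub: "{w' \<in> relators G S. int (length w') \<le> int (length w) - 1} \<subseteq> H" for H
  proof -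
    interpret H: normal H "free_group S" by (rule H)
    define \<phi> where "\<phi> u = H #>\<^bsub>free_group S\<^esub> reduce u" for u
    have short: "{w' \<in> relators G S. length w' < length w} \<subseteq> H" using sub by auto
    have cong: "\<phi> (u @ v) = \<phi> (u' @ v')"
      if "u \<in> lists (S \<times> UNIV)" "u' \<in> lists (S \<times> UNIV)" "v \<in> lists (S \<times> UNIV)"
        "v' \<in> lists (S \<times> UNIV)" "\<phi> u = \<phi> u'" "\<phi> v = \<phi> v'" for u u' v v'
      using that rcoset_reduce_append[OF H] by (simp add: \<phi>_def)
    define row where "row i = concat (map (a i) [0..<K])" for i
    have rows: "\<phi> (row i) = \<phi> (row (Suc i))" if i: "i < K" for i
    proof -
      have squares: "\<phi> (a i j @ b i (Suc j)) = \<phi> (b i j @ a (Suc i) j)" if j: "j < K" for j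
        unfolding \<phi>_def
      proof (rule rcoset_reduce_eqI[OF SG H short])
        show "a i j @ b i (Suc j) \<in> lists (S \<times> UNIV)" "b i j @ a (Suc i) j \<in> lists (S \<times> UNIV)"
          using a(1)[of i j] a(1)[of "Suc i" j] b(1)[of i j] b(1)[of i "Suc j"] i j
          by (simp_all del: in_lists_conv_set)
        have "eval_word G (a i j @ b i (Suc j))
            = (inv (y i j) \<otimes> y i (Suc j)) \<otimes> (inv (y i (Suc j)) \<otimes> y (Suc i) (Suc j))"
          using eval_word_append[OF SG a(1) b(1)] a(3) b(3) i j by simp
        also have "\<dots> = inv (y i j) \<otimes> y (Suc i) (Suc j)"
          using i j y step by (simp add: m_assoc)
        also have "\<dots> = (inv (y i j) \<otimes> y (Suc i) j) \<otimes> (inv (y (Suc i) j) \<otimes> y (Suc i) (Suc j))"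
          using i j y step by (simp add: m_assoc)
        also have "\<dots> = eval_word G (b i j @ a (Suc i) j)"
          using eval_word_append[OF SG b(1) a(1)] a(3) b(3) i j by simp
        finally show "eval_word G (a i j @ b i (Suc j)) = eval_word G (b i j @ a (Suc i) j)" .
        show "length (a i j @ b i (Suc j)) + length (b i j @ a (Suc i) j) < length w"
          using a(2)[of i j] a(2)[of "Suc i" j] b(2)[of i j] b(2)[of i "Suc j"] i j \<delta> by simp
      qed
      have "\<phi> (row i @ b i K) = \<phi> (b i 0 @ row (Suc i))"
        unfolding row_def
        by (rule commuting_squares_rows[where A = "S \<times> UNIV" and \<phi> = \<phi>, OF cong])
          (use i a(1) b(1) squares in \<open>simp_all del: in_lists_conv_set\<close>)
      then show ?thesis using b(4,5) i by simp
    qed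
    have "\<phi> (row 0) = \<phi> (row i)" if "i \<le> K" for i
      using that
    proof (induction i)
      case (Suc i)
      then show ?case using rows[of i] by simp
    qed simp
    from this[of K] have "\<phi> (row 0) = \<phi> (row K)" by simp
    moreover have "row K = []" using a(5) by (simp add: row_def)
    moreover have "row 0 = w"
    proof -
      have "row 0 = concat (map (\<lambda>j. take (t (Suc j) - t j) (drop (t j) w)) [0..<K])"
        unfolding row_def using a(4) by (intro arg_cong[where f = concat] map_cong) auto
      also have "\<dots> = take (t K) w"
        by (rule concat_take_segments) (use t in auto)
      finally show ?thesis using t(2) by simp
    qed
    ultimately have "H #>\<^bsub>free_group S\<^esub> w = H #>\<^bsub>free_group S\<^esub> \<one>\<^bsub>free_group S\<^esub>"
      using wr by (simp add: \<phi>_def reduce_reduced free_group_def)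
    then have "H #>\<^bsub>free_group S\<^esub> w = H" by (simp add: H.coset_mult_one H.subset)
    then show "w \<in> H" by (rule H.coset_join1) (use wF H.subgroup_axioms in auto)
  qed
  then show ?thesis by (auto simp: short_relators_closure_def hull_def)
qed

end

text \<open>If all relators of length at most \<open>m\<close> lay in the previous closure, every
  normal subgroup containing those of length at most \<open>m - 1\<close> would contain them too,
  and the two hulls would agree. Comparing the families of normal subgroups in this way avoids
  proving that a hull is normal. The witness has length exactly \<open>m\<close>, because shorter
  relators lie in the previous closure.\<close>

lemma relation_range_witness:
  assumes "m \<in> relation_range G S"
  shows "\<exists>w \<in> relators G S. length w = m \<and> w \<notin> short_relators_closure G S (int m - 1)"
proof -
  let ?R = "\<lambda>n. {w \<in> relators G S. int (length w) \<le> n}"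
  have "\<exists>w \<in> ?R (int m). w \<notin> short_relators_closure G S (int m - 1)"
  proof (rule ccontr)
    assume "\<not> ?thesis"
    then have "?R (int m) \<subseteq> H" if "H \<lhd> free_group S" "?R (int m - 1) \<subseteq> H" for H
      using that unfolding short_relators_closure_def hull_def by blast
    then have "short_relators_closure G S (int m) \<subseteq> short_relators_closure G S (int m - 1)"
      unfolding short_relators_closure_def hull_def by blast
    then show False using assms by (auto simp: relation_range_def)
  qed
  then obtain w where w: "w \<in> ?R (int m)" "w \<notin> short_relators_closure G S (int m - 1)" by blast
  moreover have "?R (int m - 1) \<subseteq> short_relators_closure G S (int m - 1)"
    unfolding short_relators_closure_def by (rule hull_subset)
  ultimately have "w \<notin> ?R (int m - 1)" by blast
  with w show ?thesis by auto
qed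

section \<open>Word norms\<close>

text \<open>The quotient of the two vertices is the value of the segment of \<open>w\<close> between
  the two positions. The bound remains true when \<open>i + k\<close> runs past the end of
  \<open>w\<close>, where the segment is only shorter.\<close>

lemma (in group) word_norm_prefixes:
  assumes T: "T \<subseteq> carrier G" and w: "w \<in> lists (T \<times> UNIV)" and g: "g \<in> carrier G"
  shows "word_norm G T (inv (g \<otimes> eval_word G (take i w)) \<otimes> (g \<otimes> eval_word G (take (i + k) w))) \<le> k"
proof -
  let ?u = "take k (drop i w)"
  have u: "take i w \<in> lists (T \<times> UNIV)" "?u \<in> lists (T \<times> UNIV)"
    using w by (auto dest!: in_set_takeD in_set_dropD)
  have "eval_word G (take (i + k) w) = eval_word G (take i w) \<otimes> eval_word G ?u"
    using eval_word_append[OF T u] by (simp add: take_add)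
  then have "inv (g \<otimes> eval_word G (take i w)) \<otimes> (g \<otimes> eval_word G (take (i + k) w)) = eval_word G ?u"
    using g eval_word_closed[OF T u(1)] eval_word_closed[OF T u(2)]
    by (simp add: m_assoc[symmetric]) (simp add: m_assoc)
  then have "word_norm G T (inv (g \<otimes> eval_word G (take i w)) \<otimes> (g \<otimes> eval_word G (take (i + k) w)))
      \<le> length ?u"
    by (intro word_norm_le u(2)) simp
  then show ?thesis by simp
qed

lemma (in group) word_norm_comparison:
  assumes S: "finite_generating_set G S" and T: "finite_generating_set G T"
  shows "\<exists>L::nat. L > 0 \<and> (\<forall>g\<in>carrier G. word_norm G S g \<le> L * word_norm G T g)"
proof -
  have SG: "S \<subseteq> carrier G" and TG: "T \<subseteq> carrier G" and fT: "finite T"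
    using S T by (auto simp: finite_generating_set_def)
  \<comment> \<open>The sum bounds the \<open>S\<close>-norm of every \<open>T\<close>-letter and
    makes sense for empty \<open>T\<close>; \<open>Suc\<close> makes the factor positive.\<close>
  define L where "L = Suc (\<Sum>a\<in>T \<times> UNIV. word_norm G S (eval_letter G a))"
  have mult: "word_norm G S (g \<otimes> h) \<le> word_norm G S g + word_norm G S h"
    if gh: "g \<in> carrier G" "h \<in> carrier G" for g h
  proof -
    obtain u v where u: "u \<in> lists (S \<times> UNIV)" "length u = word_norm G S g" "eval_word G u = g"
      and v: "v \<in> lists (S \<times> UNIV)" "length v = word_norm G S h" "eval_word G v = h"
      using word_norm_attained[OF S] gh by metis
    have "word_norm G S (g \<otimes> h) \<le> length (u @ v)"
      using u v eval_word_append[OF SG u(1) v(1)]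
      by (intro word_norm_le) (simp_all del: in_lists_conv_set)
    then show ?thesis using u v by simp
  qed
  have bound: "word_norm G S (eval_word G w) \<le> L * length w" if "w \<in> lists (T \<times> UNIV)" for w
    using that
  proof (induction w rule: list.induct)
    case Nil
    then show ?case using word_norm_le[of "[]" S] by simp
  next
    case (Cons a w)
    then have m: "a \<in> T \<times> UNIV" "w \<in> lists (T \<times> UNIV)" by auto
    have "word_norm G S (eval_letter G a) \<le> L"
      unfolding L_def using member_le_sum[of a "T \<times> UNIV" "\<lambda>a. word_norm G S (eval_letter G a)"] m(1) fT
      by fastforce
    moreover have "word_norm G S (eval_word G (a # w))
        \<le> word_norm G S (eval_letter G a) + word_norm G S (eval_word G w)"
      using mult[OF eval_letter_closed[OF TG m(1)] eval_word_closed[OF TG m(2)]]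
      by (simp add: eval_word_def)
    ultimately show ?case using Cons.IH[OF m(2)] by simp
  qed
  have "word_norm G S g \<le> L * word_norm G T g" if "g \<in> carrier G" for g
    using word_norm_attained[OF T that] bound by metis
  then show ?thesis by (intro exI[of _ L]) (simp add: L_def)
qed

section \<open>Maps into metric spaces\<close>

text \<open>The number \<delta> is a Lebesgue number of a cover of \<open>C\<close> by open sets on
  which \<open>h\<close> stays within \<open>e / 2\<close> of one of its values.\<close>

lemma (in Metric_space) uniformly_continuous_on_compact:
  fixes C :: "'c::metric_space set"
  assumes h: "continuous_map (top_of_set C) mtopology h" and C: "compact C" and e: "e > 0"
  shows "\<exists>\<delta>>0. \<forall>u\<in>C. \<forall>v\<in>C. dist u v < \<delta> \<longrightarrow> d (h u) (h v) < e"
proof -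
  define \<G> where "\<G> = {T. open T \<and> (\<exists>z\<in>C. \<forall>u\<in>C \<inter> T. h u \<in> mball (h z) (e / 2))}"
  have hM: "h z \<in> M" if "z \<in> C" for z
    using continuous_map_image_subset_topspace[OF h] that by auto
  have "\<exists>T\<in>\<G>. z \<in> T" if z: "z \<in> C" for z
  proof -
    have "openin (top_of_set C) {u \<in> topspace (top_of_set C). h u \<in> mball (h z) (e / 2)}"
      by (rule openin_continuous_map_preimage[OF h openin_mball])
    then obtain T where "open T" "{u \<in> C. h u \<in> mball (h z) (e / 2)} = C \<inter> T"
      by (auto simp: openin_open)
    then show ?thesis using z e hM[OF z] unfolding \<G>_def by fastforce
  qed
  then have cover: "C \<subseteq> \<Union>\<G>" by blast
  have opn: "\<And>T. T \<in> \<G> \<Longrightarrow> open T" by (simp add: \<G>_def)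
  obtain \<delta> where \<delta>: "\<delta> > 0" "\<And>u. u \<in> C \<Longrightarrow> \<exists>T\<in>\<G>. ball u \<delta> \<subseteq> T"
    using Heine_Borel_lemma[OF C cover opn] by blast
  have "d (h u) (h v) < e" if uv: "u \<in> C" "v \<in> C" "dist u v < \<delta>" for u v
  proof -
    obtain T z where "z \<in> C" "ball u \<delta> \<subseteq> T" and T: "\<And>u. u \<in> C \<inter> T \<Longrightarrow> h u \<in> mball (h z) (e / 2)"
      using \<delta>(2)[OF uv(1)] by (auto simp: \<G>_def)
    then have "u \<in> C \<inter> T" "v \<in> C \<inter> T" using uv \<delta>(1) by auto
    then have "d (h z) (h u) < e / 2" "d (h z) (h v) < e / 2" using T by fastforce+
    then show ?thesis
      using triangle[OF hM[OF uv(1)] hM[OF \<open>z \<in> C\<close>] hM[OF uv(2)]] commute[of "h u" "h z"]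
      by linarith
  qed
  with \<delta>(1) show ?thesis by blast
qed

lemma (in Metric_space) Lipschitz_imp_continuous_map:
  fixes C :: "'c::metric_space set"
  assumes M: "\<And>u. u \<in> C \<Longrightarrow> f u \<in> M" and B: "B \<ge> 0"
    and lip: "\<And>u v. u \<in> C \<Longrightarrow> v \<in> C \<Longrightarrow> d (f u) (f v) \<le> B * dist u v"
  shows "continuous_map (top_of_set C) mtopology f"
  unfolding continuous_map_to_metric
proof (intro ballI allI impI)
  fix u and e :: real
  assume "u \<in> topspace (top_of_set C)" "e > 0"
  then have u: "u \<in> C" by simp
  \<comment> \<open>Dividing by \<open>B + 1\<close> keeps the radius meaningful when
    \<open>B = 0\<close>.\<close>
  let ?U = "C \<inter> ball u (e / (B + 1))"
  have "f v \<in> mball (f u) e" if v: "v \<in> ?U" for v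
  proof -
    have "B * dist u v \<le> (B + 1) * dist u v" by (simp add: distrib_right)
    also have "\<dots> < e" using v B by (simp add: field_simps)
    finally show ?thesis using lip[OF u, of v] M u v by auto
  qed
  moreover have "openin (top_of_set C) ?U" by (auto simp: openin_open)
  moreover have "u \<in> ?U" using u B \<open>e > 0\<close> by simp
  ultimately show "\<exists>U. openin (top_of_set C) U \<and> u \<in> U \<and> (\<forall>y\<in>U. f y \<in> mball (f u) e)" by blast
qed

lemma (in Metric_space) Metric_space_divide:
  assumes "c > 0"
  shows "Metric_space M (\<lambda>u v. d u v / c)"
proof
  show "d u w / c \<le> d u v / c + d v w / c" if "u \<in> M" "v \<in> M" "w \<in> M" for u v w
    using triangle[OF that] assms by (simp add: add_divide_distrib[symmetric] divide_right_mono)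
qed (use assms commute in \<open>auto simp: less_imp_le\<close>)

section \<open>Representatives of points of an ultralimit\<close>

context
  fixes \<omega> :: "nat filter" and M :: "nat \<Rightarrow> 'a set" and d :: "nat \<Rightarrow> 'a \<Rightarrow> 'a \<Rightarrow> real"
    and x :: "nat \<Rightarrow> 'a"
  assumes uf: "ultrafilter \<omega>" and ms: "\<And>n. Metric_space (M n) (d n)" and x: "\<And>n. x n \<in> M n"
begin

lemma ultralimit_point_representative:
  assumes "A \<in> ultralimit_points \<omega> M d x"
  shows "\<exists>y\<in>A. y \<in> bounded_seqs \<omega> M d x"
  using assms equiv_class_self[OF equiv_asymp_seqs[where M = M and d = d and x = x, OF uf ms x]]
  unfolding ultralimit_points_def by (auto elim!: quotientE)

lemma ultralimit_class:
  assumes "y \<in> bounded_seqs \<omega> M d x"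
  shows "asymp_seqs \<omega> M d x `` {y} \<in> ultralimit_points \<omega> M d x" "y \<in> asymp_seqs \<omega> M d x `` {y}"
  using assms equiv_class_self[OF equiv_asymp_seqs[where M = M and d = d and x = x, OF uf ms x]]
  unfolding ultralimit_points_def by (auto intro: quotientI)

text \<open>Any choice of representatives computes the distance. This freedom lets bounds pass
  between the limit and \<omega>-almost all of the spaces, with representatives prescribed where
  needed.\<close>

lemma ultralimit_dist_tendsto:
  assumes A: "A \<in> ultralimit_points \<omega> M d x" "y \<in> A" and B: "B \<in> ultralimit_points \<omega> M d x" "z \<in> B"
  shows "((\<lambda>n. d n (y n) (z n)) \<longlongrightarrow> ultralimit_dist \<omega> M d x A B) \<omega>"
proof -
  have "y \<in> bounded_seqs \<omega> M d x" "z \<in> bounded_seqs \<omega> M d x"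
    using assms in_quotient_imp_subset[OF equiv_asymp_seqs[where M = M and d = d and x = x, OF uf ms x]]
    unfolding ultralimit_points_def by blast+
  then obtain r where "((\<lambda>n. d n (y n) (z n)) \<longlongrightarrow> r) \<omega>"
    using bounded_seqs_convergent[where M = M and d = d and x = x, OF uf ms x] by blast
  with ultralimit_dist_eq[OF uf ms x A(1) B(1) A(2) B(2) this] show ?thesis by simp
qed

end

theorem theorem1p2:
  fixes G :: "('a, 'b) monoid_scheme"
    and S :: "'a set"
    and \<omega> :: "nat filter"
    and x :: "nat \<Rightarrow> 'a"
    and s :: "nat \<Rightarrow> real"
  assumes "finitely_generated_group G"
    and "densely_related G"
    and "finite_generating_set G S"
    and "nonprincipal_ultrafilter \<omega>"
    and "\<And>n. x n \<in> carrier G"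
    and "\<And>n. s n > 0"
    and "filterlim s at_top \<omega>"
  shows "\<not> simply_connected_space (cone_topology G S \<omega> x s)"
proof
  assume sc: "simply_connected_space (cone_topology G S \<omega> x s)"

  \<comment> \<open>The cone as an ultralimit of rescaled word metrics\<close>
  note S = assms(3) and x = assms(5) and s0 = assms(6)
  have uf: "ultrafilter \<omega>" using assms(4) by (simp add: nonprincipal_ultrafilter_def)
  then have nb: "\<omega> \<noteq> bot" by (simp add: ultrafilter_def)
  interpret group G using assms(1) by (simp add: finitely_generated_group_def)
  interpret W: Metric_space "carrier G" "word_dist G S" by (rule Metric_space_word_dist[OF S])
  define D where "D n g h = word_dist G S g h / s n" for n g h
  have ms: "Metric_space (carrier G) (D n)" for n
    unfolding D_def by (rule W.Metric_space_divide[OF s0])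
  define P where "P = bounded_seqs \<omega> (\<lambda>n. carrier G) D x"
  define cls where "cls y = asymp_seqs \<omega> (\<lambda>n. carrier G) D x `` {y}" for y
  define X where "X = cone_points G S \<omega> x s"
  define \<rho> where "\<rho> = cone_dist G S \<omega> x s"
  have X: "X = ultralimit_points \<omega> (\<lambda>n. carrier G) D x"
    by (simp add: X_def cone_points_def D_def[abs_def])
  have \<rho>: "\<rho> = ultralimit_dist \<omega> (\<lambda>n. carrier G) D x"
    by (simp add: \<rho>_def cone_dist_def D_def[abs_def])
  interpret X: Metric_space X \<rho>
    unfolding X_def \<rho>_def using group_axioms S uf x s0 by (rule Metric_space_cone)
  have top: "cone_topology G S \<omega> x s = X.mtopology"
    by (simp add: cone_topology_def X_def \<rho>_def)
  have cls: "cls y \<in> X" "y \<in> cls y" if "y \<in> P" for y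
    using ultralimit_class[where M = "\<lambda>n. carrier G" and d = D and x = x, OF uf ms x] that unfolding X cls_def P_def by blast+
  have lim: "((\<lambda>n. D n (y n) (z n)) \<longlongrightarrow> \<rho> A B) \<omega>" if "A \<in> X" "y \<in> A" "B \<in> X" "z \<in> B" for A B y z
    using ultralimit_dist_tendsto[where M = "\<lambda>n. carrier G" and d = D and x = x, OF uf ms x] that unfolding X \<rho> by blast
  have rep: "\<exists>y\<in>A. y \<in> P" if "A \<in> X" for A
    using ultralimit_point_representative[where M = "\<lambda>n. carrier G" and d = D and x = x, OF uf ms x] that unfolding X P_def by blast
  have large: "eventually (\<lambda>n. s n \<ge> N) \<omega>" for N
    using assms(7) by (simp add: filterlim_at_top)

  \<comment> \<open>Relators of length comparable to the scale\<close>
  obtain T c where T: "finite_generating_set G T" and c: "c > 0"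
    and dense: "\<And>n. n \<ge> 1 \<Longrightarrow> \<exists>m\<in>relation_range G T. n \<le> m \<and> real m \<le> c * real n"
    using assms(2) unfolding densely_related_def by blast
  have TG: "T \<subseteq> carrier G" using T by (simp add: finite_generating_set_def)
  have "\<exists>w. w \<in> relators G T \<and> w \<notin> short_relators_closure G T (int (length w) - 1) \<and>
      s n \<le> real (length w) \<and> real (length w) \<le> c * (s n + 1)" for n
  proof -
    \<comment> \<open>Density is applied at \<open>s n\<close> rounded up, which is at least 1 and
      at most \<open>s n + 1\<close>.\<close>
    have "1 \<le> nat \<lceil>s n\<rceil>" using s0[of n] by linarith
    then obtain m where m: "m \<in> relation_range G T" "nat \<lceil>s n\<rceil> \<le> m" "real m \<le> c * real (nat \<lceil>s n\<rceil>)"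
      using dense by blast
    have "real (nat \<lceil>s n\<rceil>) \<le> s n + 1" "s n \<le> real (nat \<lceil>s n\<rceil>)" using s0[of n] by linarith+
    then have "s n \<le> real m" "real m \<le> c * (s n + 1)"
      using m(2,3) c by (linarith, meson mult_left_mono less_imp_le order_trans)
    with relation_range_witness[OF m(1)] show ?thesis by auto
  qed
  then obtain w where w: "\<And>n. w n \<in> relators G T"
      "\<And>n. w n \<notin> short_relators_closure G T (int (length (w n)) - 1)"
      "\<And>n. s n \<le> real (length (w n))" "\<And>n. real (length (w n)) \<le> c * (s n + 1)"
    by metis
  have wl: "w n \<in> lists (T \<times> UNIV)" and w1: "eval_word G (w n) = \<one>\<^bsub>G\<^esub>" for n
    using w(1)[of n] by (auto simp: relators_def kernel_def free_group_def)
  \<comment> \<open>\<open>L\<^sub>1\<close> will make the loops of \<open>T\<close>-words Lipschitz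
    in the cone over \<open>S\<close>; \<open>L\<^sub>2\<close> will turn short steps in the cone
    into short \<open>T\<close>-words.\<close>
  obtain L\<^sub>1 where L\<^sub>1: "L\<^sub>1 > 0" "\<And>g. g \<in> carrier G \<Longrightarrow> word_norm G S g \<le> L\<^sub>1 * word_norm G T g"
    using word_norm_comparison[OF S T] by blast
  obtain L\<^sub>2 where L\<^sub>2: "L\<^sub>2 > 0" "\<And>g. g \<in> carrier G \<Longrightarrow> word_norm G T g \<le> L\<^sub>2 * word_norm G S g"
    using word_norm_comparison[OF T S] by blast

  \<comment> \<open>The loops reading the relators and their limit\<close>
  define q where "q t n = x n \<otimes>\<^bsub>G\<^esub> eval_word G (take (nat \<lfloor>t * real (length (w n))\<rfloor>) (w n))" for t n
  have qG: "q t n \<in> carrier G" for t n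
  proof -
    have "take k (w n) \<in> lists (T \<times> UNIV)" for k using wl[of n] by (auto dest: in_set_takeD)
    then show ?thesis using x eval_word_closed[OF TG] by (simp add: q_def)
  qed
  \<comment> \<open>The loop closes up because \<open>w n\<close> is a relator.\<close>
  have q0: "q 0 = x" and q1: "q 1 = x" using x w1 by (auto simp: q_def eval_word_def)
  \<comment> \<open>Once \<open>s n \<ge> 1\<close>, the length of \<open>w n\<close> is at most
    \<open>c * (s n + 1) \<le> 2 * c * s n\<close>; the factor \<open>L\<^sub>1\<close> passes from
    \<open>T\<close> to \<open>S\<close>.\<close>
  define B where "B = 2 * c * real L\<^sub>1"
  have B: "B \<ge> 0" using c by (simp add: B_def)
  \<comment> \<open>The summand 1 accounts for rounding positions in \<open>w n\<close> down to
    integers.\<close>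
  have qdist: "word_dist G S (q t n) (q u n) \<le> L\<^sub>1 * ((u - t) * length (w n) + 1)"
    if "0 \<le> t" "t \<le> u" for t u :: real and n
  proof -
    let ?i = "nat \<lfloor>t * real (length (w n))\<rfloor>" and ?j = "nat \<lfloor>u * real (length (w n))\<rfloor>"
    have tu: "0 \<le> t * length (w n)" "t * length (w n) \<le> u * length (w n)"
      using that by (auto intro: mult_right_mono)
    then have ij: "?i \<le> ?j" by (intro nat_mono floor_mono)
    have "word_dist G S (q t n) (q u n) \<le> L\<^sub>1 * real (word_norm G T (inv\<^bsub>G\<^esub> (q t n) \<otimes>\<^bsub>G\<^esub> q u n))"
      using qG L\<^sub>1(2)[of "inv\<^bsub>G\<^esub> (q t n) \<otimes>\<^bsub>G\<^esub> q u n"] by (simp add: word_dist_def flip: of_nat_mult)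
    also have "\<dots> \<le> L\<^sub>1 * real (?j - ?i)"
      using word_norm_prefixes[OF TG wl[of n] x[of n], of ?i "?j - ?i"] ij
      by (intro mult_left_mono of_nat_mono) (auto simp: q_def)
    also have "\<dots> \<le> L\<^sub>1 * ((u - t) * length (w n) + 1)"
    proof (rule mult_left_mono)
      have "real ?j \<le> u * length (w n)" "t * length (w n) < real ?i + 1" using tu by linarith+
      then show "real (?j - ?i) \<le> (u - t) * length (w n) + 1"
        using ij by (simp add: left_diff_distrib)
    qed simp
    finally show ?thesis .
  qed
  \<comment> \<open>After rescaling, the rounding error is \<open>L\<^sub>1 / s n\<close>, which is
    at most \<open>e\<close> as soon as \<open>s n \<ge> L\<^sub>1 / e\<close>.\<close>
  have qlim: "eventually (\<lambda>n. D n (q t n) (q u n) \<le> B * \<bar>t - u\<bar> + e) \<omega>"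
    if tu: "0 \<le> t" "0 \<le> u" and e: "e > 0" for t u e :: real
    using large[of 1] large[of "L\<^sub>1 / e"]
  proof eventually_elim
    case (elim n)
    have "word_dist G S (q t n) (q u n) \<le> L\<^sub>1 * (\<bar>t - u\<bar> * length (w n) + 1)"
      using qdist[of t u n] qdist[of u t n] tu W.commute[of "q t n" "q u n"] by (cases "t \<le> u") auto
    also have "\<dots> = L\<^sub>1 * \<bar>t - u\<bar> * length (w n) + L\<^sub>1" by (simp add: algebra_simps)
    also have "\<dots> \<le> L\<^sub>1 * \<bar>t - u\<bar> * (2 * c * s n) + e * s n"
    proof (intro add_mono mult_left_mono)
      have "c * (s n + 1) \<le> c * (2 * s n)" using elim c by (intro mult_left_mono) auto
      then show "real (length (w n)) \<le> 2 * c * s n" using w(4)[of n] by simp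
      show "real L\<^sub>1 \<le> e * s n" using elim e by (simp add: field_simps)
    qed simp
    also have "\<dots> = (B * \<bar>t - u\<bar> + e) * s n" by (simp add: B_def algebra_simps)
    finally show ?case using s0[of n] by (simp add: D_def field_simps)
  qed
  have qP: "q t \<in> P" if "0 \<le> t" for t
    using qG qlim[of 0 t 1] that q0 by (auto simp: P_def bounded_seqs_def)
  define p where "p t = cls (q t)" for t
  have pX: "p t \<in> X" if "0 \<le> t" for t using cls qP that by (simp add: p_def)
  have "\<rho> (p t) (p u) \<le> B * dist t u" if tu: "t \<in> {0..1}" "u \<in> {0..1}" for t u
  proof (rule field_le_epsilon)
    fix e :: real assume "e > 0"
    show "\<rho> (p t) (p u) \<le> B * dist t u + e"
    proof (rule tendsto_upperbound[OF lim _ nb])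
      show "p t \<in> X" "p u \<in> X" "q t \<in> p t" "q u \<in> p u"
        using tu cls qP by (auto simp: p_def)
      show "eventually (\<lambda>n. D n (q t n) (q u n) \<le> B * dist t u + e) \<omega>"
        using qlim[of t u e] tu \<open>e > 0\<close> by (simp add: dist_real_def)
    qed
  qed
  then have "pathin X.mtopology p"
    unfolding pathin_def by (intro X.Lipschitz_imp_continuous_map[OF _ B] pX) auto
  moreover have p01: "p 0 = cls x" "p 1 = cls x" by (simp_all add: p_def q0 q1)
  \<comment> \<open>The first coordinate is the parameter of the homotopy, the second runs along the
    loops.\<close>
  ultimately obtain h :: "real \<times> real \<Rightarrow> (nat \<Rightarrow> 'a) set" where
      h: "continuous_map (prod_topology (top_of_set {0..1}) (top_of_set {0..1})) X.mtopology h"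
    and h0: "\<And>t. h (0, t) = p t" and h1: "\<And>t. h (1, t) = cls x"
    and hb: "\<And>u. u \<in> {0..1} \<Longrightarrow> h (u, 0) = cls x" "\<And>u. u \<in> {0..1} \<Longrightarrow> h (u, 1) = cls x"
    using sc unfolding simply_connected_space_def top homotopic_with_def by metis

  \<comment> \<open>A fine grid in the square of the null homotopy\<close>
  let ?Q = "{0..1::real} \<times> {0..1::real}"
  have hc: "continuous_map (top_of_set ?Q) X.mtopology h" using h by simp
  have hX: "h z \<in> X" if "z \<in> ?Q" for z
    using continuous_map_image_subset_topspace[OF hc] that by auto
  have "compact ?Q" by (intro compact_Times compact_Icc)
  \<comment> \<open>A step of this size in the cone lifts to an \<open>S\<close>-distance below
    \<open>s n / (5 * L\<^sub>2)\<close>, hence to a \<open>T\<close>-distance below a fifth of the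
    length of \<open>w n\<close>. Four such sides are together shorter than
    \<open>w n\<close>.\<close>
  moreover have "1 / (5 * real L\<^sub>2) > 0" using L\<^sub>2(1) by simp
  ultimately obtain \<delta> where \<delta>: "\<delta> > 0"
      "\<And>u v. u \<in> ?Q \<Longrightarrow> v \<in> ?Q \<Longrightarrow> dist u v < \<delta> \<Longrightarrow> \<rho> (h u) (h v) < 1 / (5 * real L\<^sub>2)"
    using X.uniformly_continuous_on_compact[OF hc] by meson
  obtain K\<^sub>0 :: nat where "1 / \<delta> < real K\<^sub>0" using reals_Archimedean2 by blast
  \<comment> \<open>With \<open>K \<ge> 10\<close>, each of the \<open>K\<close> pieces of
    \<open>w n\<close> has length about a tenth of the whole at most, leaving room for rounding
    within the bound of one fifth.\<close>
  define K where "K = K\<^sub>0 + 10"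
  have K: "K \<ge> 10" "1 / real K < \<delta>"
  proof -
    have "1 / \<delta> < real K" using \<open>1 / \<delta> < real K\<^sub>0\<close> by (simp add: K_def)
    then show "1 / real K < \<delta>" using \<delta>(1) by (simp add: K_def field_simps)
  qed (simp add: K_def)
  define z where "z i j = (real i / real K, real j / real K)" for i j
  have zQ: "z i j \<in> ?Q" if "i \<le> K" "j \<le> K" for i j
    using that by (auto simp: z_def divide_le_eq_1)
  have near: "\<rho> (h (z i j)) (h (z (Suc i) j)) < 1 / (5 * real L\<^sub>2)" if "i < K" "j \<le> K" for i j
    using that zQ K
    by (intro \<delta>(2)) (auto simp: z_def dist_Pair_Pair dist_real_def diff_divide_distrib[symmetric])
  have near': "\<rho> (h (z i j)) (h (z i (Suc j))) < 1 / (5 * real L\<^sub>2)" if "i \<le> K" "j < K" for i j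
    using that zQ K
    by (intro \<delta>(2)) (auto simp: z_def dist_Pair_Pair dist_real_def diff_divide_distrib[symmetric])
  \<comment> \<open>Inside the grid any representative will do. On the boundary it is prescribed, so
    that the lifted grid has exactly the boundary values required for the filling, not only
    asymptotically. The prescriptions agree at the corners of row 0 because \<open>q 0 = x\<close>
    and \<open>q 1 = x\<close>.\<close>
  have "\<exists>y. y \<in> h (z i j) \<and> y \<in> P \<and> (i = 0 \<longrightarrow> y = q (real j / real K)) \<and>
      (i = K \<or> j = 0 \<or> j = K \<longrightarrow> y = x)" if ij: "i \<le> K" "j \<le> K" for i j
  proof -
    have xP: "x \<in> P" using qP[of 0] q0 by simp
    consider "i = 0" | "i \<noteq> 0" "i = K \<or> j = 0 \<or> j = K" | "i \<noteq> 0" "i \<noteq> K" "j \<noteq> 0" "j \<noteq> K" by blast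
    then show ?thesis
    proof cases
      case 1
      then have "q (real j / real K) \<in> h (z i j)"
        using cls qP by (simp add: z_def h0 p_def)
      then show ?thesis using 1 qP[of "real j / real K"] q0 q1 K by auto
    next
      case 2
      then have "h (z i j) = cls x" using ij K h1 hb by (auto simp: z_def divide_le_eq_1)
      then show ?thesis using cls xP 2 by auto
    next
      case 3
      then show ?thesis using rep[OF hX[OF zQ[OF ij]]] by auto
    qed
  qed
  then obtain y where y: "\<forall>i j. i \<le> K \<longrightarrow> j \<le> K \<longrightarrow> y i j \<in> h (z i j) \<and> y i j \<in> P \<and>
      (i = 0 \<longrightarrow> y i j = q (real j / real K)) \<and> (i = K \<or> j = 0 \<or> j = K \<longrightarrow> y i j = x)"
    by metis
  have "eventually (\<lambda>n. D n (y i j n) (y (Suc i) j n) < 1 / (5 * real L\<^sub>2)) \<omega>"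
    if "i < K" "j \<le> K" for i j
    using order_tendstoD(2)[OF lim near[OF that]] hX zQ y that by simp
  then have ver: "eventually (\<lambda>n. \<forall>i\<in>{..<K}. \<forall>j\<in>{..K}. D n (y i j n) (y (Suc i) j n) < 1 / (5 * real L\<^sub>2)) \<omega>"
    by (intro eventually_ball_finite ballI) auto
  have "eventually (\<lambda>n. D n (y i j n) (y i (Suc j) n) < 1 / (5 * real L\<^sub>2)) \<omega>"
    if "i \<le> K" "j < K" for i j
    using order_tendstoD(2)[OF lim near'[OF that]] hX zQ y that by simp
  then have hor: "eventually (\<lambda>n. \<forall>i\<in>{..K}. \<forall>j\<in>{..<K}. D n (y i j n) (y i (Suc j) n) < 1 / (5 * real L\<^sub>2)) \<omega>"
    by (intro eventually_ball_finite ballI) auto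
  \<comment> \<open>The grid is finite, so a single \<open>n\<close> satisfies all edge conditions
    at once. The extra condition \<open>s n \<ge> 10\<close> makes \<open>w n\<close> long enough to
    absorb rounding.\<close>
  obtain n where "\<forall>i\<in>{..<K}. \<forall>j\<in>{..K}. D n (y i j n) (y (Suc i) j n) < 1 / (5 * real L\<^sub>2)"
      "\<forall>i\<in>{..K}. \<forall>j\<in>{..<K}. D n (y i j n) (y i (Suc j) n) < 1 / (5 * real L\<^sub>2)" "s n \<ge> 10"
    using eventually_happens'[OF nb eventually_conj[OF ver eventually_conj[OF hor large[of 10]]]]
    by blast
  then have n: "\<And>i j. i < K \<Longrightarrow> j \<le> K \<Longrightarrow> D n (y i j n) (y (Suc i) j n) < 1 / (5 * real L\<^sub>2)"
      "\<And>i j. i \<le> K \<Longrightarrow> j < K \<Longrightarrow> D n (y i j n) (y i (Suc j) n) < 1 / (5 * real L\<^sub>2)" "s n \<ge> 10"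
    by simp_all
  have y_side: "y i 0 = x" "y i K = x" if "i \<le> K" for i
    using y that by blast+

  \<comment> \<open>The lifted grid as a fine filling of \<open>w n\<close>\<close>
  define m where "m = length (w n)"
  have m: "m \<ge> 10" using n(3) w(3)[of n] by (simp add: m_def)
  have yG: "y i j n \<in> carrier G" if "i \<le> K" "j \<le> K" for i j
    using y that by (auto simp: P_def bounded_seqs_def)
  have short: "word_norm G T (inv\<^bsub>G\<^esub> g \<otimes>\<^bsub>G\<^esub> g') \<le> m div 5"
    if g: "g \<in> carrier G" "g' \<in> carrier G" and less: "D n g g' < 1 / (5 * real L\<^sub>2)" for g g'
  proof -
    let ?a = "word_norm G S (inv\<^bsub>G\<^esub> g \<otimes>\<^bsub>G\<^esub> g')"
    have "real ?a / s n < 1 / (5 * real L\<^sub>2)"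
      using less g by (simp add: D_def word_dist_def)
    then have "real (5 * (L\<^sub>2 * ?a)) < s n" using s0[of n] L\<^sub>2(1) by (simp add: field_simps)
    also have "\<dots> \<le> real m" using w(3) by (simp add: m_def)
    finally have "5 * (L\<^sub>2 * ?a) < m" by linarith
    then show ?thesis using L\<^sub>2(2)[of "inv\<^bsub>G\<^esub> g \<otimes>\<^bsub>G\<^esub> g'"] g by simp
  qed
  define t where "t j = nat \<lfloor>real j / real K * real m\<rfloor>" for j
  have step: "t j \<le> t (Suc j) \<and> t (Suc j) \<le> t j + m div 5" for j
  proof -
    define a b where "a = real j / real K * real m" and "b = real m / real K"
    have "real (Suc j) / real K * real m = a + b"
      by (simp add: a_def b_def add_divide_distrib distrib_right)
    then have t: "t j = nat \<lfloor>a\<rfloor>" "t (Suc j) = nat \<lfloor>a + b\<rfloor>" by (simp_all only: t_def a_def)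
    have "b \<le> real m / 10" unfolding b_def using K(1) by (intro divide_left_mono) auto
    moreover have ab: "0 \<le> a" "0 \<le> b" by (simp_all add: a_def b_def)
    moreover have "real (t (Suc j)) \<le> a + b" "a < real (t j) + 1" using t ab by linarith+
    \<comment> \<open>A segment is shorter than \<open>m / 10 + 1\<close>, and five times this is at
      most \<open>m\<close> since \<open>m \<ge> 10\<close>.\<close>
    ultimately have "5 * t (Suc j) < 5 * t j + m" using m by linarith
    moreover have "t j \<le> t (Suc j)" unfolding t using ab by (intro nat_mono floor_mono) simp
    ultimately show ?thesis by simp
  qed
  have "w n \<in> short_relators_closure G T (int (length (w n)) - 1)"
  proof (rule fine_filling_in_short_relators_closure[OF T w(1) x[of n], where K = K and
        y = "\<lambda>i j. y i j n" and t = t and \<delta> = "m div 5"])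
    show "y 0 j n = x n \<otimes>\<^bsub>G\<^esub> eval_word G (take (t j) (w n))" if "j \<le> K" for j
    proof -
      have "y 0 j = q (real j / real K)" using y that by blast
      then show ?thesis by (simp add: q_def t_def m_def)
    qed
    show "t 0 = 0" "t K = length (w n)" using K by (simp_all add: t_def m_def)
    show "4 * (m div 5) < length (w n)" using m by (simp add: m_def[symmetric])
    show "word_norm G T (inv\<^bsub>G\<^esub> (y i j n) \<otimes>\<^bsub>G\<^esub> y i (Suc j) n) \<le> m div 5" if "i \<le> K" "j < K" for i j
      using short n(2) yG that by simp
    show "word_norm G T (inv\<^bsub>G\<^esub> (y i j n) \<otimes>\<^bsub>G\<^esub> y (Suc i) j n) \<le> m div 5" if "i < K" "j \<le> K" for i j
      using short n(1) yG that by simp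
  qed (use y y_side yG step in auto)
  then show False using w(2) by blast
qed

end
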